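(* Let $G_*$ be an extended N-series acting on an extended N-series $K_*$, and set $\bar G_\bullet=\mathrm{gr}_\bullet(G_* )$, $\bar K_\bullet=\mathrm{gr}_\bullet(K_* )$. For each $m\ge 0$ let $\bar\tau_m:\bar G_m\to \mathrm{Der}_m(\bar K_\bullet)$ be the homomorphism sending $gG_{m+1}$ to the family $(\bar K_i\to\bar K_{m+i})_{i\ge 0}$ given by $aK_{i+1}\mapsto g(a)K_{i+1}$ if $m=0$, and by $aK_{i+1}\mapsto [g,a]K_{m+i+1}$ if $m\ge 1$. Then the family $\bar\tau_\bullet=(\bar\tau_m)_{m\ge 0}$ is a morphism of eg-Lie algebras $$\bar\tau_\bullet:\bar G_\bullet\longrightarrow \mathrm{Der}_\bullet(\bar K_\bullet).$$ Moreover, $\bar\tau_\bullet$ is injective (i.e. every $\bar\tau_m$ is injective) if and only if $G_*$ is the Johnson filtration $\mathcal F^{K_*}_*(G_0)$ of $G_0$ induced by $K_*$.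
   Context: Extended N-series: a descending series of groups $K_*=(K_m)_{m\ge 0}$, $K_0\ge K_1\ge K_2\ge\cdots$, with $[K_m,K_n]\le K_{m+n}$ for all $m,n\ge 0$. An action of an extended N-series $G_*$ on $K_*$ is an action (by automorphisms) of the group $G_0$ on the group $K_0$ such that $[g,k]:=g(k)k^{-1}\in K_{m+n}$ for all $g\in G_m$, $k\in K_n$, $m,n\ge 0$. Then $g(K_n)=K_n$ for all $g\in G_0$, $n\ge 0$. The Johnson filtration of $G_0$ induced by $K_*$ is $\mathcal F^{K_*}_m(G_0)=\{g\in G_0 : [g,k]\in K_{m+n}\text{ for all }k\in K_n,\ n\ge 0\}$, $m\ge 0$. Eg-Lie algebra (extended graded Lie algebra) $L_\bullet=(L_m)_{m\ge 0}$: a group $L_0$, a graded Lie algebra $L_+=(L_m)_{m\ge 1}$ over $\mathbb Z$ (with $[L_m,L_n]\subset L_{m+n}$), and an action $(g,x)\mapsto {}^gx$ of $L_0$ on $L_+$ by degree-preserving Lie algebra automorphisms. A morphism $f_\bullet:L_\bullet\to L'_\bullet$ is a group homomorphism $f_0:L_0\to L'_0$ and a graded Lie algebra morphism $f_+=(f_m)_{m\ge1}$ with $f_m({}^xy)={}^{f_0(x)}(f_m(y))$ for $x\in L_0$, $y\in L_m$, $m\ge 1$. $\mathrm{Aut}(L_\bullet)$ is the group of invertible endomorphisms. The eg-Lie algebra associated with $K_*$: $\bar K_m=\mathrm{gr}_m(K_* )=K_m/K_{m+1}$ for $m\ge 0$, with bracket $[aK_{m+1},bK_{n+1}]=[a,b]K_{m+n+1}$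 ($m,n\ge1$) and action ${}^{aK_1}(bK_{m+1})=(aba^{-1})K_{m+1}$ of $\bar K_0$. ($\bar K_m$ is abelian for $m\ge1$ and written additively.) Derivation eg-Lie algebra $\mathrm{Der}_\bullet(L_\bullet)$: $\mathrm{Der}_0(L_\bullet)=\mathrm{Aut}(L_\bullet)$. For $m\ge 1$, $\mathrm{Der}_m(L_\bullet)$ is the abelian group of families of maps $d=(d_i:L_i\to L_{m+i})_{i\ge0}$ such that (1) for $i,j\ge 1$ the $d_i$ are homomorphisms with $d_{i+j}([a,b])=[d_i(a),b]+[a,d_j(b)]$; (2) $d_0(ab)=d_0(a)+{}^a(d_0(b))$ for $a,b\in L_0$; (3) $d_i({}^ab)=[d_0(a),{}^ab]+{}^a(d_i(b))$ for $a\in L_0$, $b\in L_i$, $i\ge 1$. For $d\in \mathrm{Der}_m$, $d'\in\mathrm{Der}_n$, $m,n\ge1$, the bracket is $[d,d']_0(a)=d_n(d'_0(a))-d'_m(d_0(a))-[d_0(a),d'_0(a)]$ for $a\in L_0$, and $[d,d']_i(a)=d_{n+i}(d'_i(a))-d'_{m+i}(d_i(a))$ for $a\in L_i$, $i\ge1$. The action of $f\in \mathrm{Der}_0$ on $d\in\mathrm{Der}_m$ is $({}^fd)_i(a)=f_{m+i}d_if_i^{-1}(a)$. *)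

theory Defs
  imports "HOL-Algebra.Algebra"
begin

section \<open>Extended N-series, actions, Johnson filtration\<close>

definition commutator :: "('a, 'b) monoid_scheme \<Rightarrow> 'a \<Rightarrow> 'a \<Rightarrow> 'a" where
  "commutator G a b = a \<otimes>\<^bsub>G\<^esub> b \<otimes>\<^bsub>G\<^esub> inv\<^bsub>G\<^esub> a \<otimes>\<^bsub>G\<^esub> inv\<^bsub>G\<^esub> b"

definition commutator_subgroup :: "('a, 'b) monoid_scheme \<Rightarrow> 'a set \<Rightarrow> 'a set \<Rightarrow> 'a set" where
  "commutator_subgroup G A B = generate G {commutator G a b | a b. a \<in> A \<and> b \<in> B}"

locale ext_N_series = group K for K (structure) +
  fixes Ks :: "nat \<Rightarrow> 'a set"
  assumes term_0: "Ks 0 = carrier K"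
    and term_subgroup: "subgroup (Ks m) K"
    and term_decreasing: "Ks (Suc m) \<subseteq> Ks m"
    and commutator_le: "commutator_subgroup K (Ks m) (Ks n) \<subseteq> Ks (m + n)"

text \<open>The ``commutator'' \<open>[g, k] = g(k) k\<^sup>-\<^sup>1\<close> of a group acting on \<open>K\<close> with an element of \<open>K\<close>.\<close>

definition act_commutator ::
    "('k, 'd) monoid_scheme \<Rightarrow> ('g \<Rightarrow> 'k \<Rightarrow> 'k) \<Rightarrow> 'g \<Rightarrow> 'k \<Rightarrow> 'k" where
  "act_commutator K \<phi> g k = \<phi> g k \<otimes>\<^bsub>K\<^esub> inv\<^bsub>K\<^esub> k"

locale ext_N_series_action =
  G: ext_N_series G Gs + K: ext_N_series K Ks
  for G :: "('g, 'c) monoid_scheme" and Gs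
    and K :: "('k, 'd) monoid_scheme" and Ks +
  fixes \<phi> :: "'g \<Rightarrow> 'k \<Rightarrow> 'k"
  assumes action_hom: "\<phi> \<in> hom G (AutoGroup K)"
    and action_series: "\<lbrakk>g \<in> Gs m; k \<in> Ks n\<rbrakk> \<Longrightarrow> act_commutator K \<phi> g k \<in> Ks (m + n)"

definition johnson_filtration ::
    "('g, 'c) monoid_scheme \<Rightarrow> ('k, 'd) monoid_scheme \<Rightarrow> (nat \<Rightarrow> 'k set) \<Rightarrow>
     ('g \<Rightarrow> 'k \<Rightarrow> 'k) \<Rightarrow> nat \<Rightarrow> 'g set" where
  "johnson_filtration G K Ks \<phi> m =
     {g \<in> carrier G. \<forall>n. \<forall>k\<in>Ks n. act_commutator K \<phi> g k \<in> Ks (m + n)}"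


section \<open>Extended graded Lie algebras\<close>

text \<open>
  The group in degree \<open>0\<close> and the abelian groups in positive degrees are all given as
  multiplicatively written HOL-Algebra groups, so the sum \<open>x + y\<close> and the opposite \<open>-x\<close> in
  \<open>L\<^sub>m\<close>, \<open>m \<ge> 1\<close>, appear as \<open>x \<otimes>\<^bsub>egl_part L m\<^esub> y\<close> and \<open>inv\<^bsub>egl_part L m\<^esub> x\<close>.
  The field \<open>egl_bracket L m n :: L\<^sub>m \<times> L\<^sub>n \<rightarrow> L\<^sub>m\<^sub>+\<^sub>n\<close> is meaningful for \<open>m, n \<ge> 1\<close> only, and
  \<open>egl_act L m :: L\<^sub>0 \<times> L\<^sub>m \<rightarrow> L\<^sub>m\<close> for \<open>m \<ge> 1\<close> only.
\<close>

record 'a eg_lie =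
  egl_part :: "nat \<Rightarrow> 'a monoid"
  egl_bracket :: "nat \<Rightarrow> nat \<Rightarrow> 'a \<Rightarrow> 'a \<Rightarrow> 'a"
  egl_act :: "nat \<Rightarrow> 'a \<Rightarrow> 'a \<Rightarrow> 'a"

text \<open>
  The axioms of a Lie algebra over the integers on the direct sum of the \<open>L\<^sub>m\<close>, \<open>m \<ge> 1\<close>, are
  stated on homogeneous elements: \<open>[x, x] = 0\<close> on the direct sum amounts to
  \<open>[x, x] = 0\<close> and \<open>[x, y] = -[y, x]\<close> for homogeneous \<open>x\<close>, \<open>y\<close>.
\<close>

locale eg_lie_algebra =
  fixes L :: "'a eg_lie"
  assumes part_0_group: "group (egl_part L 0)"
    and part_comm_group: "m \<ge> 1 \<Longrightarrow> comm_group (egl_part L m)"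
    and bracket_hom_right:
      "\<lbrakk>m \<ge> 1; n \<ge> 1; x \<in> carrier (egl_part L m)\<rbrakk> \<Longrightarrow>
        (\<lambda>y. egl_bracket L m n x y) \<in> hom (egl_part L n) (egl_part L (m + n))"
    and bracket_hom_left:
      "\<lbrakk>m \<ge> 1; n \<ge> 1; y \<in> carrier (egl_part L n)\<rbrakk> \<Longrightarrow>
        (\<lambda>x. egl_bracket L m n x y) \<in> hom (egl_part L m) (egl_part L (m + n))"
    and bracket_self:
      "\<lbrakk>m \<ge> 1; x \<in> carrier (egl_part L m)\<rbrakk> \<Longrightarrow>
        egl_bracket L m m x x = \<one>\<^bsub>egl_part L (m + m)\<^esub>"
    and bracket_antisym:
      "\<lbrakk>m \<ge> 1; n \<ge> 1; x \<in> carrier (egl_part L m); y \<in> carrier (egl_part L n)\<rbrakk> \<Longrightarrow>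
        egl_bracket L m n x y = inv\<^bsub>egl_part L (m + n)\<^esub> (egl_bracket L n m y x)"
    and jacobi:
      "\<lbrakk>m \<ge> 1; n \<ge> 1; p \<ge> 1;
        x \<in> carrier (egl_part L m); y \<in> carrier (egl_part L n); z \<in> carrier (egl_part L p)\<rbrakk> \<Longrightarrow>
        egl_bracket L m (n + p) x (egl_bracket L n p y z)
          \<otimes>\<^bsub>egl_part L (m + n + p)\<^esub> egl_bracket L n (p + m) y (egl_bracket L p m z x)
          \<otimes>\<^bsub>egl_part L (m + n + p)\<^esub> egl_bracket L p (m + n) z (egl_bracket L m n x y)
        = \<one>\<^bsub>egl_part L (m + n + p)\<^esub>"
    and act_hom: "m \<ge> 1 \<Longrightarrow> egl_act L m \<in> hom (egl_part L 0) (AutoGroup (egl_part L m))"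
    and act_bracket:
      "\<lbrakk>m \<ge> 1; n \<ge> 1; g \<in> carrier (egl_part L 0);
        x \<in> carrier (egl_part L m); y \<in> carrier (egl_part L n)\<rbrakk> \<Longrightarrow>
        egl_act L (m + n) g (egl_bracket L m n x y) =
          egl_bracket L m n (egl_act L m g x) (egl_act L n g y)"

locale eg_lie_hom = L: eg_lie_algebra L + L': eg_lie_algebra L'
  for L :: "'a eg_lie" and L' :: "'b eg_lie" +
  fixes f :: "nat \<Rightarrow> 'a \<Rightarrow> 'b"
  assumes part_hom: "f m \<in> hom (egl_part L m) (egl_part L' m)"
    and map_bracket:
      "\<lbrakk>m \<ge> 1; n \<ge> 1; x \<in> carrier (egl_part L m); y \<in> carrier (egl_part L n)\<rbrakk> \<Longrightarrow>
        f (m + n) (egl_bracket L m n x y) = egl_bracket L' m n (f m x) (f n y)"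
    and map_act:
      "\<lbrakk>m \<ge> 1; g \<in> carrier (egl_part L 0); y \<in> carrier (egl_part L m)\<rbrakk> \<Longrightarrow>
        f m (egl_act L m g y) = egl_act L' m (f 0 g) (f m y)"


section \<open>The eg-Lie algebra associated with an extended N-series\<close>

text \<open>
  Since \<open>K\<^sub>m\<^sub>+\<^sub>1\<close> is normal in \<open>K\<^sub>0\<close>, the cosets \<open>a K\<^sub>m\<^sub>+\<^sub>1\<close> are the library's
  \<open>Ks (Suc m) #>\<^bsub>K\<^esub> a\<close>. The operations on cosets are defined as the unique value obtained
  from all choices of representatives; for an extended N-series such a value exists, see
  \<open>gr_bracket_coset\<close> and \<open>gr_act_coset\<close> below.
\<close>

definition gr_part :: "('a, 'b) monoid_scheme \<Rightarrow> (nat \<Rightarrow> 'a set) \<Rightarrow> nat \<Rightarrow> 'a set monoid" where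
  "gr_part K Ks m = (K\<lparr>carrier := Ks m\<rparr>) Mod Ks (Suc m)"

definition gr_bracket ::
    "('a, 'b) monoid_scheme \<Rightarrow> (nat \<Rightarrow> 'a set) \<Rightarrow> nat \<Rightarrow> nat \<Rightarrow> 'a set \<Rightarrow> 'a set \<Rightarrow> 'a set" where
  "gr_bracket K Ks m n A B =
     the_elem ((\<lambda>(a, b). Ks (Suc (m + n)) #>\<^bsub>K\<^esub> commutator K a b) ` (A \<times> B))"

definition gr_act ::
    "('a, 'b) monoid_scheme \<Rightarrow> (nat \<Rightarrow> 'a set) \<Rightarrow> nat \<Rightarrow> 'a set \<Rightarrow> 'a set \<Rightarrow> 'a set" where
  "gr_act K Ks m A = (\<lambda>B \<in> carrier (gr_part K Ks m).
     the_elem ((\<lambda>(a, b). Ks (Suc m) #>\<^bsub>K\<^esub> (a \<otimes>\<^bsub>K\<^esub> b \<otimes>\<^bsub>K\<^esub> inv\<^bsub>K\<^esub> a)) ` (A \<times> B)))"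

definition gr :: "('a, 'b) monoid_scheme \<Rightarrow> (nat \<Rightarrow> 'a set) \<Rightarrow> 'a set eg_lie" where
  "gr K Ks = \<lparr>egl_part = gr_part K Ks, egl_bracket = gr_bracket K Ks, egl_act = gr_act K Ks\<rparr>"


section \<open>The derivation eg-Lie algebra\<close>

text \<open>
  Families of maps out of the \<open>L\<^sub>i\<close> are taken extensional, so that equality of families is
  equality of the maps on the \<open>L\<^sub>i\<close>.
\<close>

definition eg_aut :: "'a eg_lie \<Rightarrow> (nat \<Rightarrow> 'a \<Rightarrow> 'a) set" where
  "eg_aut L = {f. (\<forall>i. f i \<in> extensional (carrier (egl_part L i))) \<and> eg_lie_hom L L f \<and>
     (\<exists>g. eg_lie_hom L L g \<and>
        (\<forall>i. \<forall>x\<in>carrier (egl_part L i). g i (f i x) = x \<and> f i (g i x) = x))}"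

definition eg_aut_group :: "'a eg_lie \<Rightarrow> (nat \<Rightarrow> 'a \<Rightarrow> 'a) monoid" where
  "eg_aut_group L =
     \<lparr>carrier = eg_aut L,
      monoid.mult = \<lambda>f g i. compose (carrier (egl_part L i)) (f i) (g i),
      monoid.one = \<lambda>i. \<lambda>x\<in>carrier (egl_part L i). x\<rparr>"

definition eg_der :: "'a eg_lie \<Rightarrow> nat \<Rightarrow> (nat \<Rightarrow> 'a \<Rightarrow> 'a) set" where
  "eg_der L m = {d.
     (\<forall>i. d i \<in> carrier (egl_part L i) \<rightarrow>\<^sub>E carrier (egl_part L (m + i))) \<and>
     (\<forall>i\<ge>1. d i \<in> hom (egl_part L i) (egl_part L (m + i))) \<and>
     (\<forall>i\<ge>1. \<forall>j\<ge>1. \<forall>a\<in>carrier (egl_part L i). \<forall>b\<in>carrier (egl_part L j).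
        d (i + j) (egl_bracket L i j a b) =
          egl_bracket L (m + i) j (d i a) b
            \<otimes>\<^bsub>egl_part L (m + i + j)\<^esub> egl_bracket L i (m + j) a (d j b)) \<and>
     (\<forall>a\<in>carrier (egl_part L 0). \<forall>b\<in>carrier (egl_part L 0).
        d 0 (a \<otimes>\<^bsub>egl_part L 0\<^esub> b) = d 0 a \<otimes>\<^bsub>egl_part L m\<^esub> egl_act L m a (d 0 b)) \<and>
     (\<forall>i\<ge>1. \<forall>a\<in>carrier (egl_part L 0). \<forall>b\<in>carrier (egl_part L i).
        d i (egl_act L i a b) =
          egl_bracket L m i (d 0 a) (egl_act L i a b)
            \<otimes>\<^bsub>egl_part L (m + i)\<^esub> egl_act L (m + i) a (d i b))}"

definition eg_der_group :: "'a eg_lie \<Rightarrow> nat \<Rightarrow> (nat \<Rightarrow> 'a \<Rightarrow> 'a) monoid" where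
  "eg_der_group L m =
     \<lparr>carrier = eg_der L m,
      monoid.mult = \<lambda>d d' i. \<lambda>a\<in>carrier (egl_part L i). d i a \<otimes>\<^bsub>egl_part L (m + i)\<^esub> d' i a,
      monoid.one = \<lambda>i. \<lambda>a\<in>carrier (egl_part L i). \<one>\<^bsub>egl_part L (m + i)\<^esub>\<rparr>"

definition eg_der_bracket ::
    "'a eg_lie \<Rightarrow> nat \<Rightarrow> nat \<Rightarrow> (nat \<Rightarrow> 'a \<Rightarrow> 'a) \<Rightarrow> (nat \<Rightarrow> 'a \<Rightarrow> 'a) \<Rightarrow> (nat \<Rightarrow> 'a \<Rightarrow> 'a)" where
  "eg_der_bracket L m n d d' = (\<lambda>i. \<lambda>a\<in>carrier (egl_part L i).
     if i = 0
     then d n (d' 0 a)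
            \<otimes>\<^bsub>egl_part L (m + n)\<^esub> inv\<^bsub>egl_part L (m + n)\<^esub> (d' m (d 0 a))
            \<otimes>\<^bsub>egl_part L (m + n)\<^esub> inv\<^bsub>egl_part L (m + n)\<^esub> (egl_bracket L m n (d 0 a) (d' 0 a))
     else d (n + i) (d' i a)
            \<otimes>\<^bsub>egl_part L (m + n + i)\<^esub> inv\<^bsub>egl_part L (m + n + i)\<^esub> (d' (m + i) (d i a)))"

definition eg_der_act ::
    "'a eg_lie \<Rightarrow> nat \<Rightarrow> (nat \<Rightarrow> 'a \<Rightarrow> 'a) \<Rightarrow> (nat \<Rightarrow> 'a \<Rightarrow> 'a) \<Rightarrow> (nat \<Rightarrow> 'a \<Rightarrow> 'a)" where
  "eg_der_act L m f = (\<lambda>d\<in>eg_der L m. \<lambda>i. \<lambda>a\<in>carrier (egl_part L i).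
     f (m + i) (d i (inv_into (carrier (egl_part L i)) (f i) a)))"

definition Der :: "'a eg_lie \<Rightarrow> (nat \<Rightarrow> 'a \<Rightarrow> 'a) eg_lie" where
  "Der L =
     \<lparr>egl_part = (\<lambda>m. if m = 0 then eg_aut_group L else eg_der_group L m),
      egl_bracket = eg_der_bracket L,
      egl_act = eg_der_act L\<rparr>"


section \<open>The maps \<open>\<tau>\<^sub>m\<close>\<close>

definition tau_rep ::
    "('k, 'd) monoid_scheme \<Rightarrow> (nat \<Rightarrow> 'k set) \<Rightarrow> ('g \<Rightarrow> 'k \<Rightarrow> 'k) \<Rightarrow>
     nat \<Rightarrow> 'g \<Rightarrow> nat \<Rightarrow> 'k \<Rightarrow> 'k set" where
  "tau_rep K Ks \<phi> m g i a =
     (if m = 0 then Ks (Suc i) #>\<^bsub>K\<^esub> \<phi> g a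
      else Ks (Suc (m + i)) #>\<^bsub>K\<^esub> act_commutator K \<phi> g a)"

definition tau ::
    "('k, 'd) monoid_scheme \<Rightarrow> (nat \<Rightarrow> 'k set) \<Rightarrow> ('g \<Rightarrow> 'k \<Rightarrow> 'k) \<Rightarrow>
     nat \<Rightarrow> 'g set \<Rightarrow> nat \<Rightarrow> 'k set \<Rightarrow> 'k set" where
  "tau K Ks \<phi> m A = (\<lambda>i. \<lambda>B\<in>carrier (gr_part K Ks i).
     the_elem ((\<lambda>(g, a). tau_rep K Ks \<phi> m g i a) ` (A \<times> B)))"


section \<open>The operations on \<open>gr K Ks\<close> are well defined\<close>

lemma the_elem_representatives:
  assumes "a \<in> A" "b \<in> B" and eq: "\<And>x y. \<lbrakk>x \<in> A; y \<in> B\<rbrakk> \<Longrightarrow> f x y = c"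
  shows "the_elem ((\<lambda>(x, y). f x y) ` (A \<times> B)) = c"
proof -
  have "(\<lambda>(x, y). f x y) ` (A \<times> B) = (\<lambda>_. c) ` (A \<times> B)"
    by (rule image_cong) (auto simp: eq)
  also have "\<dots> = {c}"
    using assms(1,2) by blast
  finally show ?thesis by simp
qed

context ext_N_series
begin

lemma term_carrier: "a \<in> Ks m \<Longrightarrow> a \<in> carrier K"
  using subgroup.mem_carrier term_subgroup by metis

lemma commutator_in: "\<lbrakk>a \<in> Ks m; b \<in> Ks n\<rbrakk> \<Longrightarrow> commutator K a b \<in> Ks (m + n)"
  using commutator_le[of m n] unfolding commutator_subgroup_def
  by (blast intro: generate.incl)

lemma term_normal: "Ks m \<lhd> K"
  unfolding normal_inv_iff
proof (intro conjI ballI)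
  show "subgroup (Ks m) K" by (rule term_subgroup)
next
  fix x h assume x: "x \<in> carrier K" and h: "h \<in> Ks m"
  have "commutator K x h \<in> Ks m"
    using commutator_in[of x 0 h m] x h term_0 by simp
  then have "commutator K x h \<otimes> h \<in> Ks m"
    using h subgroup.m_closed term_subgroup by metis
  moreover have "commutator K x h \<otimes> h = x \<otimes> h \<otimes> inv x"
    using x term_carrier[OF h] by (simp add: commutator_def m_assoc)
  ultimately show "x \<otimes> h \<otimes> inv x \<in> Ks m" by simp
qed

lemma commutator_inv:
  "\<lbrakk>a \<in> carrier K; b \<in> carrier K\<rbrakk> \<Longrightarrow> inv (commutator K a b) = commutator K b a"
  by (simp add: commutator_def inv_mult_group m_assoc)

lemma cancel_inv [simp]:
  "\<lbrakk>a \<in> carrier K; b \<in> carrier K\<rbrakk> \<Longrightarrow> inv a \<otimes> (a \<otimes> b) = b"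
  "\<lbrakk>a \<in> carrier K; b \<in> carrier K\<rbrakk> \<Longrightarrow> a \<otimes> (inv a \<otimes> b) = b"
  by (simp_all flip: m_assoc)

lemma coset_absorb:
  assumes "h \<in> Ks m" "c \<in> carrier K"
  shows "Ks m #> (h \<otimes> c) = Ks m #> c"
proof -
  have "Ks m #> h = Ks m"
    using assms(1) term_carrier coset_join2 term_subgroup by blast
  then show ?thesis
    using coset_mult_assoc[of "Ks m" h c] assms term_carrier
      subgroup.subset[OF term_subgroup] by simp
qed

lemma commutator_coset_left:
  assumes a: "a \<in> Ks m" and b: "b \<in> Ks n" and x: "x \<in> Ks (Suc m)"
  shows "Ks (Suc (m + n)) #> commutator K (x \<otimes> a) b = Ks (Suc (m + n)) #> commutator K a b"
proof -
  interpret N: normal "Ks (Suc (m + n))" K by (rule term_normal)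
  have c: "a \<in> carrier K" "b \<in> carrier K" "x \<in> carrier K"
    using assms term_carrier by blast+
  let ?c = "commutator K a b"
  have cc: "?c \<in> carrier K" using c by (simp add: commutator_def)
  have split: "commutator K (x \<otimes> a) b = x \<otimes> ?c \<otimes> inv x \<otimes> commutator K x b"
    using c by (simp add: commutator_def m_assoc inv_mult_group)
  have "commutator K x ?c \<in> Ks (Suc m + (m + n))"
    by (intro commutator_in x a b)
  moreover have "Ks (k + j) \<subseteq> Ks k" for k j
    by (induction j) (use term_decreasing in auto)
  then have "Ks (Suc (m + n) + m) \<subseteq> Ks (Suc (m + n))" .
  ultimately have 1: "commutator K x ?c \<in> Ks (Suc (m + n))"
    by (auto simp: algebra_simps)
  have 2: "commutator K x b \<in> Ks (Suc (m + n))"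
    using commutator_in[OF x b] by simp
  have 3: "?c \<otimes> commutator K x b \<otimes> inv ?c \<in> Ks (Suc (m + n))"
    using N.inv_op_closed2 cc 2 by simp
  have c2: "commutator K x b \<in> carrier K" using c by (simp add: commutator_def)
  have "commutator K (x \<otimes> a) b =
      (commutator K x ?c \<otimes> (?c \<otimes> commutator K x b \<otimes> inv ?c)) \<otimes> ?c"
    unfolding split using c cc c2
    by (simp add: commutator_def[of K x ?c] m_assoc)
  moreover have "commutator K x ?c \<otimes> (?c \<otimes> commutator K x b \<otimes> inv ?c) \<in> Ks (Suc (m + n))"
    using 1 3 by (rule N.m_closed)
  ultimately show ?thesis
    using cc by (simp add: coset_absorb)
qed

lemma commutator_coset_right:
  assumes a: "a \<in> Ks m" and b: "b \<in> Ks n" and y: "y \<in> Ks (Suc n)"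
  shows "Ks (Suc (m + n)) #> commutator K a (y \<otimes> b) = Ks (Suc (m + n)) #> commutator K a b"
proof -
  interpret N: normal "Ks (Suc (m + n))" K by (rule term_normal)
  have c: "a \<in> carrier K" "b \<in> carrier K" "y \<in> carrier K"
    using assms term_carrier by blast+
  have "Ks (Suc (m + n)) #> commutator K (y \<otimes> b) a = Ks (Suc (m + n)) #> commutator K b a"
    using commutator_coset_left[OF b a y] by (simp add: add.commute)
  then have "set_inv (Ks (Suc (m + n)) #> commutator K (y \<otimes> b) a)
    = set_inv (Ks (Suc (m + n)) #> commutator K b a)" by simp
  moreover have "commutator K (y \<otimes> b) a \<in> carrier K" "commutator K b a \<in> carrier K"
    using c by (simp_all add: commutator_def)
  ultimately show ?thesis
    using c by (simp add: N.rcos_inv commutator_inv)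
qed

lemma gr_part_carrier: "carrier (gr_part K Ks m) = (\<lambda>a. Ks (Suc m) #> a) ` Ks m"
  by (auto simp: gr_part_def FactGroup_def RCOSETS_def r_coset_def)

lemma gr_bracket_coset:
  assumes a: "a \<in> Ks m" and b: "b \<in> Ks n"
  shows "egl_bracket (gr K Ks) m n (Ks (Suc m) #> a) (Ks (Suc n) #> b) =
    Ks (Suc (m + n)) #> commutator K a b"
proof -
  have eq: "Ks (Suc (m + n)) #> commutator K a' b' = Ks (Suc (m + n)) #> commutator K a b"
    if a': "a' \<in> Ks (Suc m) #> a" and b': "b' \<in> Ks (Suc n) #> b" for a' b'
  proof -
    obtain x y where x: "x \<in> Ks (Suc m)" "a' = x \<otimes> a" and y: "y \<in> Ks (Suc n)" "b' = y \<otimes> b"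
      using a' b' by (auto simp: r_coset_def)
    have "y \<otimes> b \<in> Ks n"
      using y b term_decreasing subgroup.m_closed[OF term_subgroup] by blast
    then show ?thesis
      using commutator_coset_left[OF a _ x(1)] commutator_coset_right[OF a b y(1)] x y by simp
  qed
  have mem: "a \<in> Ks (Suc m) #> a" "b \<in> Ks (Suc n) #> b"
    using a b rcos_self term_carrier term_subgroup by blast+
  show ?thesis
    using the_elem_representatives[OF mem eq] by (simp add: gr_def gr_bracket_def)
qed

lemma gr_act_coset:
  assumes a: "a \<in> carrier K" and b: "b \<in> Ks m"
  shows "egl_act (gr K Ks) m (Ks 1 #> a) (Ks (Suc m) #> b) = Ks (Suc m) #> (a \<otimes> b \<otimes> inv a)"
proof -
  interpret N: normal "Ks (Suc m)" K by (rule term_normal)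
  have bc: "b \<in> carrier K" using b by (rule term_carrier)
  have eq: "Ks (Suc m) #> (a' \<otimes> b' \<otimes> inv a') = Ks (Suc m) #> (a \<otimes> b \<otimes> inv a)"
    if a': "a' \<in> Ks 1 #> a" and b': "b' \<in> Ks (Suc m) #> b" for a' b'
  proof -
    obtain x y where x: "x \<in> Ks 1" "a' = x \<otimes> a" and y: "y \<in> Ks (Suc m)" "b' = y \<otimes> b"
      using a' b' by (auto simp: r_coset_def)
    have xc: "x \<in> carrier K" and yc: "y \<in> carrier K" using x y term_carrier by blast+
    let ?e = "a \<otimes> b \<otimes> inv a"
    have ec: "?e \<in> carrier K" using a bc by simp
    have "?e \<in> Ks m"
      using normal.inv_op_closed2[OF term_normal a b] .
    then have 1: "commutator K x ?e \<in> Ks (Suc m)"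
      using commutator_in[OF x(1)] by (metis plus_1_eq_Suc)
    have 2: "a' \<otimes> y \<otimes> inv a' \<in> Ks (Suc m)"
      using N.inv_op_closed2 y x a xc by simp
    have "a' \<otimes> b' \<otimes> inv a' = ((a' \<otimes> y \<otimes> inv a') \<otimes> commutator K x ?e) \<otimes> ?e"
      using a bc xc yc by (simp add: x y commutator_def m_assoc inv_mult_group)
    moreover have "(a' \<otimes> y \<otimes> inv a') \<otimes> commutator K x ?e \<in> Ks (Suc m)"
      using 2 1 by (rule N.m_closed)
    ultimately show ?thesis
      using ec by (simp add: coset_absorb)
  qed
  have mem: "a \<in> Ks 1 #> a" "b \<in> Ks (Suc m) #> b"
    using a bc rcos_self term_subgroup by blast+
  have "Ks (Suc m) #> b \<in> carrier (gr_part K Ks m)"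
    using b by (simp add: gr_part_carrier)
  then show ?thesis
    using the_elem_representatives[OF mem eq] by (simp add: gr_def gr_act_def)
qed

end

end

theory Submission
  imports Defs
begin

text \<open>
  Write $[g, a] = g(a)\, a^{-1}$ for $g \in G_m$ and $a \in K_i$. Everything follows from the way
  this element of $K_{m+i}$ depends on $g$ and $a$ modulo $K_{m+i+1}$. Each of
  $[g, ab]$, $[gh, a]$, $[g, [a,b]]$, $[g, aba^{-1}]$ and $[[g,h], a]$ has an exact expression by
  conjugates and products of commutators, and a conjugation $uxu^{-1}$ with $u \in K_p$,
  $x \in K_q$ changes $x$ only by an element of $K_{p+q}$. Dropping what lies too deep in the
  filtration leaves five congruences (\<open>acomm_mult_right_cong\<close>, \<open>acomm_mult_left_cong\<close>,
  \<open>acomm_commutator_right\<close>, \<open>acomm_conj_right\<close>, \<open>acomm_commutator_left\<close>). Read in the quotients,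
  they say in turn that $\bar\tau_m(g)$ is additive, that $\bar\tau_m$ is a homomorphism, that
  $\bar\tau_m(g)$ satisfies the Leibniz rule, that it is compatible with the action of
  $\bar K_0$, and that $\bar\tau_\bullet$ preserves brackets. In degree $0$ the element $g$ acts by
  automorphisms of the whole series, and all the identities needed there are exact.

  That \<open>gr K Ks\<close> is an eg-Lie algebra is the same calculation for the action of $K_0$ on itself by
  conjugation, for which $[g, a]$ is the ordinary commutator; the Jacobi identity is the Leibniz
  rule of this action.

  That \<open>Der L\<close> is an eg-Lie algebra is a statement about an arbitrary \<open>L\<close>. In positive degrees it is
  the familiar Lie algebra of derivations of $L_+$. In degree $0$, fix $a \in L_0$ and
  associate with $d \in \mathrm{Der}_m$ the pair of the derivation $d_+$ and the element
  $d_0(a) \in L_m$: the formula for $[d, d']_0(a)$ is the bracket of such pairs in the semidirect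
  product of the derivations of $L_+$ with $L_+$ taken with the opposite bracket, and this
  is why it satisfies the Jacobi identity.

  For the last claim, let $F_m$ be the Johnson filtration. The family $\bar\tau_m(gG_{m+1})$ is
  trivial exactly when $[g, a] \in K_{m+1+i}$ for all $i$ and all $a \in K_i$, that is, when
  $g \in F_{m+1}$. So $\bar\tau_m$ is injective if and only if $G_m \cap F_{m+1} \subseteq G_{m+1}$.
  Since $G_m \subseteq F_m$ always and $G_0 = F_0$, these inclusions for all $m$ give $G_m = F_m$
  by induction.
\<close>

section \<open>Identities in abelian groups\<close>

text \<open>
  The free abelian group on the carrier of an abelian group \<open>G\<close> maps onto \<open>G\<close> by the homomorphism
  which is the identity on generators; \<open>denotes G c x\<close> says that this evaluation sends the formal
  integer combination \<open>c\<close> to \<open>x\<close>. Quantifying over all homomorphisms with this property avoids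
  naming one of them.
\<close>

definition denotes :: "('a, 'b) monoid_scheme \<Rightarrow> ('a \<Rightarrow>\<^sub>0 int) \<Rightarrow> 'a \<Rightarrow> bool" where
  "denotes G c x \<longleftrightarrow> Poly_Mapping.keys c \<subseteq> carrier G \<and>
     (\<forall>h \<in> hom (free_Abelian_group (carrier G)) G. (\<forall>y\<in>carrier G. h (frag_of y) = y) \<longrightarrow> h c = x)"

lemma denotes_mult:
  "\<lbrakk>denotes G c x; denotes G c' y\<rbrakk> \<Longrightarrow> denotes G (c + c') (x \<otimes>\<^bsub>G\<^esub> y)"
  using keys_add[of c c'] unfolding denotes_def hom_def
  by auto

lemma denotes_inv:
  assumes "comm_group G" "denotes G c x"
  shows "denotes G (- c) (inv\<^bsub>G\<^esub> x)"
  unfolding denotes_def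
proof (intro conjI ballI impI)
  show "Poly_Mapping.keys (- c) \<subseteq> carrier G"
    using assms(2) by (simp add: denotes_def)
next
  fix h assume h: "h \<in> hom (free_Abelian_group (carrier G)) G" "\<forall>y\<in>carrier G. h (frag_of y) = y"
  interpret comm_group G by fact
  interpret group_hom "free_Abelian_group (carrier G)" G h
    using h(1) by (simp add: group_hom_def group_hom_axioms_def)
  show "h (- c) = inv\<^bsub>G\<^esub> x"
    using hom_inv[of c] assms(2) h by (auto simp: denotes_def)
qed

lemma denotes_one:
  assumes "comm_group G"
  shows "denotes G 0 \<one>\<^bsub>G\<^esub>"
  unfolding denotes_def
proof (intro conjI ballI impI)
  fix h assume h: "h \<in> hom (free_Abelian_group (carrier G)) G"
  interpret comm_group G by fact
  interpret group_hom "free_Abelian_group (carrier G)" G h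
    using h(1) by (simp add: group_hom_def group_hom_axioms_def)
  show "h 0 = \<one>\<^bsub>G\<^esub>"
    using hom_one by simp
qed simp

lemma denotes_atom: "x \<in> carrier G \<Longrightarrow> denotes G (frag_of x) x"
  by (auto simp: denotes_def)

text \<open>
  Products and inverses in \<open>G\<close> correspond to sums and negatives of formal combinations, by the rules
  before this lemma. Hence an identity between elements of \<open>G\<close> built from products and inverses
  follows from the same identity in the additive group of formal combinations, in which terms can be
  reordered and cancelled freely. The rules also compute the two combinations from the shape of
  the two elements.
\<close>

lemma denotes_unique:
  assumes "denotes G c x" "denotes G c' y" "comm_group G" "c = c'"
  shows "x = y"
proof -
  obtain h where "h \<in> hom (free_Abelian_group (carrier G)) G" "\<And>x. x \<in> carrier G \<Longrightarrow> h (frag_of x) = x"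
    using comm_group.free_Abelian_group_universal[OF assms(3), of "\<lambda>x. x" "carrier G"] by auto
  then show ?thesis using assms by (force simp: denotes_def)
qed

lemmas denotes_intros = denotes_mult denotes_inv denotes_one denotes_atom

section \<open>Calculus in an eg-Lie algebra\<close>

context eg_lie_algebra
begin

abbreviation "P \<equiv> egl_part L"
abbreviation "C k \<equiv> carrier (egl_part L k)"
abbreviation "br \<equiv> egl_bracket L"
abbreviation "act \<equiv> egl_act L"

lemma part_comm [simp]: "0 < k \<Longrightarrow> comm_group (P k)"
  using part_comm_group by simp

lemma part_group [simp]: "group (P k)"
  using part_comm[of k] part_0_group by (cases "k = 0") (auto simp: comm_group_def)

lemma part_monoid [simp]: "monoid (P k)"
  by (rule group.is_monoid) simp

lemma mult_closed [simp]: "\<lbrakk>x \<in> C k; y \<in> C k\<rbrakk> \<Longrightarrow> x \<otimes>\<^bsub>P k\<^esub> y \<in> C k"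
  by (rule monoid.m_closed) simp_all

lemma inv_closed [simp]: "x \<in> C k \<Longrightarrow> inv\<^bsub>P k\<^esub> x \<in> C k"
  by (rule group.inv_closed) simp_all

lemma one_closed [simp]: "\<one>\<^bsub>P k\<^esub> \<in> C k"
  by (rule monoid.one_closed) simp_all

text \<open>
  The degree of a homogeneous element is often known only up to reassociating a sum. The degree of
  the result is therefore a variable of its own here and in several rules below.
\<close>

lemma br_closed [simp]:
  "\<lbrakk>x \<in> C m; y \<in> C n; 0 < m; 0 < n; k = m + n\<rbrakk> \<Longrightarrow> br m n x y \<in> C k"
  using bracket_hom_right[of m n x] by (auto simp: hom_def)

lemma br_hom_right:
  "\<lbrakk>x \<in> C m; 0 < m; 0 < n\<rbrakk> \<Longrightarrow> group_hom (P n) (P (m + n)) (br m n x)"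
  using bracket_hom_right[of m n x] by (simp add: group_hom_def group_hom_axioms_def)

lemma br_hom_left:
  "\<lbrakk>y \<in> C n; 0 < m; 0 < n\<rbrakk> \<Longrightarrow> group_hom (P m) (P (m + n)) (\<lambda>x. br m n x y)"
  using bracket_hom_left[of m n y] by (simp add: group_hom_def group_hom_axioms_def)

lemma br_mult_right:
  "\<lbrakk>x \<in> C m; y \<in> C n; z \<in> C n; 0 < m; 0 < n\<rbrakk> \<Longrightarrow>
    br m n x (y \<otimes>\<^bsub>P n\<^esub> z) = br m n x y \<otimes>\<^bsub>P (m + n)\<^esub> br m n x z"
  using group_hom.hom_mult[OF br_hom_right] .

lemma br_inv_right:
  "\<lbrakk>x \<in> C m; y \<in> C n; 0 < m; 0 < n\<rbrakk> \<Longrightarrow>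
    br m n x (inv\<^bsub>P n\<^esub> y) = inv\<^bsub>P (m + n)\<^esub> (br m n x y)"
  using group_hom.hom_inv[OF br_hom_right] .

lemma br_one_right:
  "\<lbrakk>x \<in> C m; 0 < m; 0 < n\<rbrakk> \<Longrightarrow> br m n x \<one>\<^bsub>P n\<^esub> = \<one>\<^bsub>P (m + n)\<^esub>"
  using group_hom.hom_one[OF br_hom_right] .

lemma br_mult_left:
  "\<lbrakk>x \<in> C m; y \<in> C m; z \<in> C n; 0 < m; 0 < n\<rbrakk> \<Longrightarrow>
    br m n (x \<otimes>\<^bsub>P m\<^esub> y) z = br m n x z \<otimes>\<^bsub>P (m + n)\<^esub> br m n y z"
  using group_hom.hom_mult[OF br_hom_left] .

lemma br_inv_left:
  "\<lbrakk>x \<in> C m; z \<in> C n; 0 < m; 0 < n\<rbrakk> \<Longrightarrow>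
    br m n (inv\<^bsub>P m\<^esub> x) z = inv\<^bsub>P (m + n)\<^esub> (br m n x z)"
  using group_hom.hom_inv[OF br_hom_left] .

lemma br_one_left:
  "\<lbrakk>z \<in> C n; 0 < m; 0 < n\<rbrakk> \<Longrightarrow> br m n \<one>\<^bsub>P m\<^esub> z = \<one>\<^bsub>P (m + n)\<^esub>"
  using group_hom.hom_one[OF br_hom_left] .

lemmas br_linear = br_mult_right br_inv_right br_one_right br_mult_left br_inv_left br_one_left

lemma act_auto:
  assumes "g \<in> C 0" "0 < m"
  shows "act m g \<in> hom (P m) (P m) \<inter> Bij (C m)"
  using act_hom[of m] assms by (auto simp: hom_def AutoGroup_def auto_def)

lemma act_group_hom: "\<lbrakk>g \<in> C 0; 0 < m\<rbrakk> \<Longrightarrow> group_hom (P m) (P m) (act m g)"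
  using act_auto by (simp add: group_hom_def group_hom_axioms_def)

lemma act_linear:
  "\<lbrakk>g \<in> C 0; x \<in> C m; y \<in> C m; 0 < m\<rbrakk> \<Longrightarrow>
    act m g (x \<otimes>\<^bsub>P m\<^esub> y) = act m g x \<otimes>\<^bsub>P m\<^esub> act m g y"
  "\<lbrakk>g \<in> C 0; x \<in> C m; 0 < m\<rbrakk> \<Longrightarrow> act m g (inv\<^bsub>P m\<^esub> x) = inv\<^bsub>P m\<^esub> (act m g x)"
  "\<lbrakk>g \<in> C 0; 0 < m\<rbrakk> \<Longrightarrow> act m g \<one>\<^bsub>P m\<^esub> = \<one>\<^bsub>P m\<^esub>"
  using group_hom.hom_mult[OF act_group_hom] group_hom.hom_inv[OF act_group_hom]
    group_hom.hom_one[OF act_group_hom] by blast+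

lemma act_closed [simp]: "\<lbrakk>g \<in> C 0; x \<in> C m; 0 < m\<rbrakk> \<Longrightarrow> act m g x \<in> C m"
  using group_hom.hom_closed[OF act_group_hom] .

lemma act_br:
  "\<lbrakk>g \<in> C 0; x \<in> C m; y \<in> C n; 0 < m; 0 < n; k = m + n\<rbrakk> \<Longrightarrow>
    act k g (br m n x y) = br m n (act m g x) (act n g y)"
  using act_bracket[of m n g x y] by simp

lemma br_anti:
  "\<lbrakk>x \<in> C m; y \<in> C n; 0 < m; 0 < n\<rbrakk> \<Longrightarrow> br m n x y = inv\<^bsub>P (m + n)\<^esub> (br n m y x)"
  using bracket_antisym[of m n x y] by simp

text \<open>
  The Jacobi identity, rewritten so that nested brackets are moved to the right argument. It is
  what makes $[d, d']$ compatible with the action of $L_0$: applying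
  $d$ and $d'$ one after the other produces the terms
  $[d'_0(a), [d_0(a), x]] - [d_0(a), [d'_0(a), x]]$, where the formula for $[d, d']_0$
  provides $-[[d_0(a), d'_0(a)], x]$.
\<close>

lemma br_br:
  assumes xyz: "x \<in> C m" "y \<in> C n" "z \<in> C p" and pos: "0 < m" "0 < n" "0 < p"
  shows "br (m + n) p (br m n x y) z =
    br m (n + p) x (br n p y z) \<otimes>\<^bsub>P (m + n + p)\<^esub> inv\<^bsub>P (m + n + p)\<^esub> (br n (m + p) y (br m p x z))"
    (is "?l = ?r")
proof -
  interpret comm_group "P (m + n + p)" using pos by simp
  have 1: "?l = inv\<^bsub>P (m + n + p)\<^esub> (br p (m + n) z (br m n x y))"
    using br_anti[of "br m n x y" "m + n" z p] assms by simp
  have 2: "br n (p + m) y (br p m z x) = inv\<^bsub>P (m + n + p)\<^esub> (br n (m + p) y (br m p x z))"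
    using assms by (simp add: br_anti[of z p x m] br_linear add_ac)
  have J: "br m (n + p) x (br n p y z) \<otimes>\<^bsub>P (m + n + p)\<^esub> br n (p + m) y (br p m z x) \<otimes>\<^bsub>P (m + n + p)\<^esub>
    br p (m + n) z (br m n x y) = \<one>\<^bsub>P (m + n + p)\<^esub>"
    using jacobi[of m n p x y z] assms by simp
  have "br n (p + m) y (br p m z x) \<in> C (m + n + p)" "br m (n + p) x (br n p y z) \<in> C (m + n + p)"
     "br p (m + n) z (br m n x y) \<in> C (m + n + p)"
    using assms by simp_all
  then have "br m (n + p) x (br n p y z) \<otimes>\<^bsub>P (m + n + p)\<^esub> br n (p + m) y (br p m z x) = ?l"
    using J unfolding 1 by (metis inv_equality inv_closed inv_inv m_closed)
  then show ?thesis unfolding 2 by simp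
qed

lemma eg_derI:
  assumes "\<And>i. d i \<in> extensional (C i)"
    and "\<And>i x. x \<in> C i \<Longrightarrow> d i x \<in> C (m + i)"
    and "\<And>i x y. \<lbrakk>0 < i; x \<in> C i; y \<in> C i\<rbrakk> \<Longrightarrow> d i (x \<otimes>\<^bsub>P i\<^esub> y) = d i x \<otimes>\<^bsub>P (m + i)\<^esub> d i y"
    and "\<And>i j x y. \<lbrakk>0 < i; 0 < j; x \<in> C i; y \<in> C j\<rbrakk> \<Longrightarrow>
      d (i + j) (br i j x y) = br (m + i) j (d i x) y \<otimes>\<^bsub>P (m + i + j)\<^esub> br i (m + j) x (d j y)"
    and "\<And>a b. \<lbrakk>a \<in> C 0; b \<in> C 0\<rbrakk> \<Longrightarrow> d 0 (a \<otimes>\<^bsub>P 0\<^esub> b) = d 0 a \<otimes>\<^bsub>P m\<^esub> act m a (d 0 b)"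
    and "\<And>i a x. \<lbrakk>0 < i; a \<in> C 0; x \<in> C i\<rbrakk> \<Longrightarrow>
      d i (act i a x) = br m i (d 0 a) (act i a x) \<otimes>\<^bsub>P (m + i)\<^esub> act (m + i) a (d i x)"
  shows "d \<in> eg_der L m"
  using assms by (auto simp: eg_der_def PiE_def hom_def Suc_le_eq)

end

locale eg_derivation = eg_lie_algebra L for L :: "'a eg_lie" +
  fixes m :: nat and d :: "nat \<Rightarrow> 'a \<Rightarrow> 'a"
  assumes m_pos [simp]: "0 < m" and der: "d \<in> eg_der L m"
begin

lemma d_ext [simp]: "d i \<in> extensional (C i)"
  using der by (auto simp: eg_der_def PiE_def)

lemma d_closed [simp]: "\<lbrakk>x \<in> C i; k = m + i\<rbrakk> \<Longrightarrow> d i x \<in> C k"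
  using der by (auto simp: eg_der_def)

lemma d_group_hom: "0 < i \<Longrightarrow> group_hom (P i) (P (m + i)) (d i)"
  using der by (auto simp: eg_der_def group_hom_def group_hom_axioms_def)

lemma d_linear:
  "\<lbrakk>0 < i; x \<in> C i; y \<in> C i\<rbrakk> \<Longrightarrow>
    d i (x \<otimes>\<^bsub>P i\<^esub> y) = d i x \<otimes>\<^bsub>P (m + i)\<^esub> d i y"
  "\<lbrakk>0 < i; x \<in> C i\<rbrakk> \<Longrightarrow> d i (inv\<^bsub>P i\<^esub> x) = inv\<^bsub>P (m + i)\<^esub> (d i x)"
  "0 < i \<Longrightarrow> d i \<one>\<^bsub>P i\<^esub> = \<one>\<^bsub>P (m + i)\<^esub>"
  using group_hom.hom_mult[OF d_group_hom] group_hom.hom_inv[OF d_group_hom]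
    group_hom.hom_one[OF d_group_hom] by blast+

lemma d_br:
  "\<lbrakk>0 < i; 0 < j; x \<in> C i; y \<in> C j; k = i + j\<rbrakk> \<Longrightarrow>
    d k (br i j x y) = br (m + i) j (d i x) y \<otimes>\<^bsub>P (m + i + j)\<^esub> br i (m + j) x (d j y)"
  using der by (auto simp: eg_der_def)

lemma d_mult:
  "\<lbrakk>a \<in> C 0; b \<in> C 0\<rbrakk> \<Longrightarrow> d 0 (a \<otimes>\<^bsub>P 0\<^esub> b) = d 0 a \<otimes>\<^bsub>P m\<^esub> act m a (d 0 b)"
  using der by (auto simp: eg_der_def)

lemma d_act:
  "\<lbrakk>0 < i; a \<in> C 0; x \<in> C i\<rbrakk> \<Longrightarrow>
      d i (act i a x) = br m i (d 0 a) (act i a x) \<otimes>\<^bsub>P (m + i)\<^esub> act (m + i) a (d i x)"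
  using der by (auto simp: eg_der_def)

end

section \<open>The groups of derivations\<close>

context eg_lie_algebra
begin

lemma eg_derivationI: "\<lbrakk>0 < m; d \<in> eg_der L m\<rbrakk> \<Longrightarrow> eg_derivation L m d"
  by (simp add: eg_derivation_def eg_derivation_axioms_def eg_lie_algebra_axioms)

lemma eg_der_mult:
  assumes "0 < m" "d \<in> eg_der L m" "d' \<in> eg_der L m"
  shows "d \<otimes>\<^bsub>eg_der_group L m\<^esub> d' \<in> eg_der L m"
proof -
  interpret d: eg_derivation L m d using assms by (intro eg_derivationI)
  interpret d': eg_derivation L m d' using assms by (intro eg_derivationI)
  show ?thesis
    apply (rule eg_derI; simp add: eg_der_group_def d.d_linear d'.d_linear d.d_br d'.d_br
        d.d_mult d'.d_mult d.d_act d'.d_act br_linear act_linear add_ac)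
    apply (rule denotes_unique, ((rule denotes_intros | simp add: add_ac; fail)+)[3],
        simp add: algebra_simps)+
    done
qed

lemma eg_der_one:
  assumes "0 < m"
  shows "\<one>\<^bsub>eg_der_group L m\<^esub> \<in> eg_der L m"
  by (rule eg_derI; simp add: eg_der_group_def br_linear act_linear assms add_ac)

lemma eg_der_inv:
  assumes "0 < m" "d \<in> eg_der L m"
  shows "(\<lambda>i. \<lambda>a\<in>C i. inv\<^bsub>P (m + i)\<^esub> (d i a)) \<in> eg_der L m"
proof -
  interpret d: eg_derivation L m d using assms by (intro eg_derivationI)
  show ?thesis
    apply (rule eg_derI; simp add: eg_der_group_def d.d_linear d.d_br d.d_mult d.d_act br_linear act_linear add_ac)
    apply (rule denotes_unique, ((rule denotes_intros | simp add: assms add_ac; fail)+)[3],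
        simp add: algebra_simps)+
    done
qed

lemma eg_der_group_comm:
  assumes "0 < m"
  shows "comm_group (eg_der_group L m)"
proof (rule comm_groupI)
  fix d assume "d \<in> carrier (eg_der_group L m)"
  then have d: "d \<in> eg_der L m" by (simp add: eg_der_group_def)
  interpret d: eg_derivation L m d using assms d by (intro eg_derivationI)
  interpret comm_group "P (m + i)" for i using assms by simp
  show "\<one>\<^bsub>eg_der_group L m\<^esub> \<otimes>\<^bsub>eg_der_group L m\<^esub> d = d"
    by (rule ext, rule extensionalityI[of _ "C _"]) (auto simp: eg_der_group_def)
  show "\<exists>d'\<in>carrier (eg_der_group L m). d' \<otimes>\<^bsub>eg_der_group L m\<^esub> d = \<one>\<^bsub>eg_der_group L m\<^esub>"
    using eg_der_inv[OF assms d]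
    by (intro bexI[of _ "\<lambda>i. \<lambda>a\<in>C i. inv\<^bsub>P (m + i)\<^esub> (d i a)"]) (auto simp: eg_der_group_def intro!: ext)
next
  fix d d' d'' assume *: "d \<in> carrier (eg_der_group L m)" "d' \<in> carrier (eg_der_group L m)"
  then interpret d: eg_derivation L m d + d': eg_derivation L m d'
    using assms by (auto intro: eg_derivationI simp: eg_der_group_def)
  interpret comm_group "P (m + i)" for i using assms by simp
  show "d \<otimes>\<^bsub>eg_der_group L m\<^esub> d' = d' \<otimes>\<^bsub>eg_der_group L m\<^esub> d"
    by (rule ext) (auto simp: eg_der_group_def restrict_def m_comm)
  assume "d'' \<in> carrier (eg_der_group L m)"
  then interpret d'': eg_derivation L m d''
    using assms by (auto intro: eg_derivationI simp: eg_der_group_def)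
  show "d \<otimes>\<^bsub>eg_der_group L m\<^esub> d' \<otimes>\<^bsub>eg_der_group L m\<^esub> d'' = d \<otimes>\<^bsub>eg_der_group L m\<^esub> (d' \<otimes>\<^bsub>eg_der_group L m\<^esub> d'')"
    by (rule ext) (auto simp: eg_der_group_def restrict_def m_assoc)
qed (use assms eg_der_mult eg_der_one in \<open>auto simp: eg_der_group_def\<close>)

section \<open>The bracket of derivations\<close>

lemma eg_der_bracket_0:
  "a \<in> C 0 \<Longrightarrow> eg_der_bracket L m n d d' 0 a = d n (d' 0 a) \<otimes>\<^bsub>P (m + n)\<^esub> inv\<^bsub>P (m + n)\<^esub> (d' m (d 0 a))
     \<otimes>\<^bsub>P (m + n)\<^esub> inv\<^bsub>P (m + n)\<^esub> (br m n (d 0 a) (d' 0 a))"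
  by (simp add: eg_der_bracket_def)

lemma eg_der_bracket_pos:
  "\<lbrakk>0 < i; a \<in> C i\<rbrakk> \<Longrightarrow> eg_der_bracket L m n d d' i a = d (n + i) (d' i a)
     \<otimes>\<^bsub>P (m + n + i)\<^esub> inv\<^bsub>P (m + n + i)\<^esub> (d' (m + i) (d i a))"
  by (simp add: eg_der_bracket_def)

lemma eg_der_bracket_ext: "eg_der_bracket L m n d d' i \<in> extensional (C i)"
  by (simp add: eg_der_bracket_def)

text \<open>
  All conditions are checked by expanding both sides with the rules for \<open>d\<close> and \<open>d'\<close> into sums of
  double applications $d d' x$, $d' d x$ and brackets. In degree $0$ the mixed terms
  $[d_0(a), {}^a d'_0(b)]$ and $[d'_0(a), {}^a d_0(b)]$ come from the condition on actions for $d$ and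
  $d'$; the extra summand $-[d_0(a), d'_0(a)]$ in the definition of the bracket is what removes them.
\<close>

lemma eg_der_bracket_closed:
  assumes "0 < m" "0 < n" "d \<in> eg_der L m" "d' \<in> eg_der L n" and k: "k = m + n"
  shows "eg_der_bracket L m n d d' \<in> eg_der L k"
proof -
  interpret d: eg_derivation L m d using assms by (intro eg_derivationI)
  interpret d': eg_derivation L n d' using assms by (intro eg_derivationI)
  note S = eg_der_bracket_0 eg_der_bracket_pos d.d_linear d'.d_linear d.d_br d'.d_br
    d.d_mult d'.d_mult d.d_act d'.d_act br_linear act_linear act_br add_ac
  show ?thesis unfolding k
  proof (rule eg_derI)
    fix i show "eg_der_bracket L m n d d' i \<in> extensional (C i)" by (rule eg_der_bracket_ext)
    fix x show "x \<in> C i \<Longrightarrow> eg_der_bracket L m n d d' i x \<in> C (m + n + i)"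
      by (cases "i = 0") (simp_all add: S)
  next
    fix i x y assume "0 < i" "x \<in> C i" "y \<in> C i"
    then show "eg_der_bracket L m n d d' i (x \<otimes>\<^bsub>P i\<^esub> y) =
       eg_der_bracket L m n d d' i x \<otimes>\<^bsub>P (m + n + i)\<^esub> eg_der_bracket L m n d d' i y"
      apply (simp add: S)
      apply (rule denotes_unique, ((rule denotes_intros | simp add: add_ac; fail)+)[3],
        simp add: algebra_simps)
      done
  next
    fix i j x y assume "0 < i" "0 < j" "x \<in> C i" "y \<in> C j"
    then show "eg_der_bracket L m n d d' (i + j) (br i j x y) =
       br (m + n + i) j (eg_der_bracket L m n d d' i x) y
       \<otimes>\<^bsub>P (m + n + i + j)\<^esub> br i (m + n + j) x (eg_der_bracket L m n d d' j y)"
      apply (simp add: S)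
      apply (rule denotes_unique, ((rule denotes_intros | simp add: add_ac; fail)+)[3],
        simp add: algebra_simps)
      done
  next
    fix a b assume "a \<in> C 0" "b \<in> C 0"
    \<comment> \<open>Antisymmetry brings the two occurrences of the second mixed term into the same form.\<close>
    then show "eg_der_bracket L m n d d' 0 (a \<otimes>\<^bsub>P 0\<^esub> b) =
       eg_der_bracket L m n d d' 0 a \<otimes>\<^bsub>P (m + n)\<^esub> act (m + n) a (eg_der_bracket L m n d d' 0 b)"
      apply (simp add: S br_anti[of "d' 0 a" n "act m a (d 0 b)" m])
      apply (rule denotes_unique, ((rule denotes_intros | simp add: add_ac; fail)+)[3],
        simp add: algebra_simps)
      done
  next
    fix i a x assume "0 < i" "a \<in> C 0" "x \<in> C i"
    then show "eg_der_bracket L m n d d' i (act i a x) =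
       br (m + n) i (eg_der_bracket L m n d d' 0 a) (act i a x)
       \<otimes>\<^bsub>P (m + n + i)\<^esub> act (m + n + i) a (eg_der_bracket L m n d d' i x)"
      apply (simp add: S br_br)
      apply (rule denotes_unique, ((rule denotes_intros | simp add: add_ac; fail)+)[3],
        simp add: algebra_simps)
      done
  qed
qed

lemma eg_der_eqI:
  assumes "d \<in> eg_der L m" "d' \<in> eg_der L m" "\<And>x. x \<in> C 0 \<Longrightarrow> d 0 x = d' 0 x"
    "\<And>i x. \<lbrakk>0 < i; x \<in> C i\<rbrakk> \<Longrightarrow> d i x = d' i x"
  shows "d = d'"
proof
  fix i
  have "\<And>x. x \<in> C i \<Longrightarrow> d i x = d' i x"
    using assms(3,4) by (cases "i = 0") auto
  moreover have "d i \<in> extensional (C i)" "d' i \<in> extensional (C i)"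
    using assms(1,2) by (auto simp: eg_der_def PiE_def)
  ultimately show "d i = d' i" by (rule extensionalityI[rotated 2])
qed

lemma eg_der_group_apply:
  "x \<in> C i \<Longrightarrow> (d \<otimes>\<^bsub>eg_der_group L m\<^esub> d') i x = d i x \<otimes>\<^bsub>P (m + i)\<^esub> d' i x"
  "x \<in> C i \<Longrightarrow> \<one>\<^bsub>eg_der_group L m\<^esub> i x = \<one>\<^bsub>P (m + i)\<^esub>"
  by (simp_all add: eg_der_group_def)

lemma eg_der_group_carrier [simp]: "carrier (eg_der_group L m) = eg_der L m"
  by (simp add: eg_der_group_def)

lemma eg_der_inv_apply:
  assumes "0 < m" "d \<in> eg_der L m" "x \<in> C i"
  shows "(inv\<^bsub>eg_der_group L m\<^esub> d) i x = inv\<^bsub>P (m + i)\<^esub> (d i x)"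
proof -
  interpret d: eg_derivation L m d using assms by (intro eg_derivationI)
  interpret D: comm_group "eg_der_group L m" using eg_der_group_comm assms by simp
  interpret comm_group "P (m + i)" for i using assms by simp
  have "inv\<^bsub>eg_der_group L m\<^esub> d = (\<lambda>i. \<lambda>a\<in>C i. inv\<^bsub>P (m + i)\<^esub> (d i a))"
    by (rule D.inv_equality) (use eg_der_inv assms in \<open>auto simp: eg_der_group_def intro!: ext\<close>)
  then show ?thesis using assms by simp
qed

lemma eg_der_bracket_hom:
  assumes "0 < m" "0 < n" "d \<in> eg_der L m"
  shows "(\<lambda>d'. eg_der_bracket L m n d d') \<in> hom (eg_der_group L n) (eg_der_group L (m + n))"
    and "(\<lambda>d'. eg_der_bracket L n m d' d) \<in> hom (eg_der_group L n) (eg_der_group L (n + m))"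
proof -
  interpret d: eg_derivation L m d using assms by (intro eg_derivationI)
  have "eg_der_bracket L m n d (d' \<otimes>\<^bsub>eg_der_group L n\<^esub> d'') =
      eg_der_bracket L m n d d' \<otimes>\<^bsub>eg_der_group L (m + n)\<^esub> eg_der_bracket L m n d d'' \<and>
     eg_der_bracket L n m (d' \<otimes>\<^bsub>eg_der_group L n\<^esub> d'') d =
      eg_der_bracket L n m d' d \<otimes>\<^bsub>eg_der_group L (n + m)\<^esub> eg_der_bracket L n m d'' d"
    if d': "d' \<in> eg_der L n" "d'' \<in> eg_der L n" for d' d''
  proof -
    interpret d': eg_derivation L n d' using assms d' by (intro eg_derivationI)
    interpret d'': eg_derivation L n d'' using assms d' by (intro eg_derivationI)
    note S = eg_der_bracket_0 eg_der_bracket_pos eg_der_group_apply d.d_linear d'.d_linear d''.d_linear br_linear add_ac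
    have "d' \<otimes>\<^bsub>eg_der_group L n\<^esub> d'' \<in> eg_der L n"
      using d' assms eg_der_mult by simp
    note c = this d' assms eg_der_bracket_closed eg_der_mult
    show ?thesis
    proof (intro conjI)
      show "eg_der_bracket L m n d (d' \<otimes>\<^bsub>eg_der_group L n\<^esub> d'') =
          eg_der_bracket L m n d d' \<otimes>\<^bsub>eg_der_group L (m + n)\<^esub> eg_der_bracket L m n d d''"
        apply (rule eg_der_eqI[of _ "m + n"])
           apply (simp_all add: c)
         apply (simp_all add: S)
         apply (rule denotes_unique, ((rule denotes_intros | simp add: assms add_ac; fail)+)[3],
        simp add: algebra_simps)+
        done
      show "eg_der_bracket L n m (d' \<otimes>\<^bsub>eg_der_group L n\<^esub> d'') d =
          eg_der_bracket L n m d' d \<otimes>\<^bsub>eg_der_group L (n + m)\<^esub> eg_der_bracket L n m d'' d"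
        apply (rule eg_der_eqI[of _ "n + m"])
           apply (simp_all add: c)
         apply (simp_all add: S)
         apply (rule denotes_unique, ((rule denotes_intros | simp add: assms add_ac; fail)+)[3],
        simp add: algebra_simps)+
        done
    qed
  qed
  then show "(\<lambda>d'. eg_der_bracket L m n d d') \<in> hom (eg_der_group L n) (eg_der_group L (m + n))"
    "(\<lambda>d'. eg_der_bracket L n m d' d) \<in> hom (eg_der_group L n) (eg_der_group L (n + m))"
    using assms eg_der_bracket_closed by (auto simp: hom_def)
qed

lemma eg_der_bracket_anti:
  assumes "0 < m" "0 < n" "d \<in> eg_der L m" "d' \<in> eg_der L n"
  shows "eg_der_bracket L m n d d' = inv\<^bsub>eg_der_group L (m + n)\<^esub> (eg_der_bracket L n m d' d)"
proof -
  interpret d: eg_derivation L m d using assms by (intro eg_derivationI)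
  interpret d': eg_derivation L n d' using assms by (intro eg_derivationI)
  interpret D: comm_group "eg_der_group L (m + n)" using eg_der_group_comm assms by simp
  have c: "eg_der_bracket L n m d' d \<in> eg_der L (m + n)"
    using assms by (simp add: eg_der_bracket_closed)
  note S = eg_der_bracket_0 eg_der_bracket_pos eg_der_inv_apply c add_ac br_anti[of "d' 0 _" n "d 0 _" m]
  show ?thesis
    apply (rule eg_der_eqI[of _ "m + n"])
       apply (use assms eg_der_bracket_closed in simp)
      apply (use c D.inv_closed in simp)
     apply (simp_all add: S assms)
    apply (rule denotes_unique, ((rule denotes_intros | simp add: assms add_ac; fail)+)[3],
        simp add: algebra_simps)+
    done
qed

lemma eg_der_bracket_self:
  assumes "0 < m" "d \<in> eg_der L m"
  shows "eg_der_bracket L m m d d = \<one>\<^bsub>eg_der_group L (m + m)\<^esub>"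
proof -
  interpret d: eg_derivation L m d using assms by (intro eg_derivationI)
  show ?thesis
    apply (rule eg_der_eqI[of _ "m + m"])
       apply (use assms eg_der_bracket_closed in simp)
      apply (use assms eg_der_one in simp)
     apply (simp_all add: eg_der_bracket_0 eg_der_bracket_pos eg_der_group_apply bracket_self assms(1) Suc_leI add_ac)
    apply (rule denotes_unique, ((rule denotes_intros | simp add: assms add_ac; fail)+)[3],
        simp add: algebra_simps)+
    done
qed

text \<open>
  In positive degrees the twelve triple applications cancel in pairs. In degree $0$ write $x, y, z$
  for $d_0(a), d'_0(a), d''_0(a)$. Besides the triple applications there are terms such as
  $-[dy, z] - [y, dz]$, which cancel against $-[z, dy] + [y, dz]$ from the two other summands, and
  the double brackets $[x,[y,z]] + [y,[z,x]] + [z,[x,y]]$, which vanish by the Jacobi identity of \<open>L\<close>.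
\<close>

lemma eg_der_jacobi:
  assumes "0 < m" "0 < n" "0 < p" "d \<in> eg_der L m" "d' \<in> eg_der L n" "d'' \<in> eg_der L p"
  shows "eg_der_bracket L m (n + p) d (eg_der_bracket L n p d' d'')
    \<otimes>\<^bsub>eg_der_group L (m + n + p)\<^esub> eg_der_bracket L n (p + m) d' (eg_der_bracket L p m d'' d)
    \<otimes>\<^bsub>eg_der_group L (m + n + p)\<^esub> eg_der_bracket L p (m + n) d'' (eg_der_bracket L m n d d') =
    \<one>\<^bsub>eg_der_group L (m + n + p)\<^esub>"
proof -
  interpret d: eg_derivation L m d using assms by (intro eg_derivationI)
  interpret d': eg_derivation L n d' using assms by (intro eg_derivationI)
  interpret d'': eg_derivation L p d'' using assms by (intro eg_derivationI)
  have c: "eg_der_bracket L m (n + p) d (eg_der_bracket L n p d' d'') \<in> eg_der L (m + n + p)"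
   "eg_der_bracket L n (p + m) d' (eg_der_bracket L p m d'' d) \<in> eg_der L (m + n + p)"
   "eg_der_bracket L p (m + n) d'' (eg_der_bracket L m n d d') \<in> eg_der L (m + n + p)"
    using assms by (simp_all add: eg_der_bracket_closed)
  note S = eg_der_bracket_0 eg_der_bracket_pos eg_der_group_apply d.d_linear d'.d_linear d''.d_linear
    d.d_br d'.d_br d''.d_br br_linear add_ac
  show ?thesis
  proof (rule eg_der_eqI[of _ "m + n + p"])
    fix a assume a: "a \<in> C 0"
    let ?x = "d 0 a" and ?y = "d' 0 a" and ?z = "d'' 0 a"
    \<comment> \<open>Every bracket with a derivative is given the form in which the underived element comes first.\<close>
    have antisym:
      "br (m + n) p (d n ?y) ?z = inv\<^bsub>P (m + n + p)\<^esub> (br p (m + n) ?z (d n ?y))"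
      "br (m + n) p (d' m ?x) ?z = inv\<^bsub>P (m + n + p)\<^esub> (br p (m + n) ?z (d' m ?x))"
      "br (m + p) n (d p ?z) ?y = inv\<^bsub>P (m + n + p)\<^esub> (br n (m + p) ?y (d p ?z))"
      "br (m + p) n (d'' m ?x) ?y = inv\<^bsub>P (m + n + p)\<^esub> (br n (m + p) ?y (d'' m ?x))"
      "br (n + p) m (d' p ?z) ?x = inv\<^bsub>P (m + n + p)\<^esub> (br m (n + p) ?x (d' p ?z))"
      "br (n + p) m (d'' n ?y) ?x = inv\<^bsub>P (m + n + p)\<^esub> (br m (n + p) ?x (d'' n ?y))"
      by (subst br_anti; use a assms in \<open>simp add: add_ac\<close>)+
    have jacobi': "br p (m + n) ?z (br m n ?x ?y) =
        inv\<^bsub>P (m + n + p)\<^esub> (br m (n + p) ?x (br n p ?y ?z)) \<otimes>\<^bsub>P (m + n + p)\<^esub>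
        inv\<^bsub>P (m + n + p)\<^esub> (br n (m + p) ?y (br p m ?z ?x))"
      using a br_anti[of ?z p "br m n ?x ?y" "m + n"] br_br[of ?x m ?y n ?z p]
      apply (simp add: br_anti[of ?x m ?z p] br_linear add_ac)
      apply (rule denotes_unique, ((rule denotes_intros | simp add: assms add_ac; fail)+)[3],
        simp add: algebra_simps)
      done
    show "(eg_der_bracket L m (n + p) d (eg_der_bracket L n p d' d'')
      \<otimes>\<^bsub>eg_der_group L (m + n + p)\<^esub> eg_der_bracket L n (p + m) d' (eg_der_bracket L p m d'' d)
      \<otimes>\<^bsub>eg_der_group L (m + n + p)\<^esub> eg_der_bracket L p (m + n) d'' (eg_der_bracket L m n d d')) 0 a =
      \<one>\<^bsub>eg_der_group L (m + n + p)\<^esub> 0 a"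
      using a apply (simp add: S antisym jacobi')
      apply (rule denotes_unique, ((rule denotes_intros | simp add: assms add_ac; fail)+)[3],
        simp add: algebra_simps)
      done
  next
    fix i a assume a: "0 < i" "a \<in> C i"
    then show "(eg_der_bracket L m (n + p) d (eg_der_bracket L n p d' d'')
      \<otimes>\<^bsub>eg_der_group L (m + n + p)\<^esub> eg_der_bracket L n (p + m) d' (eg_der_bracket L p m d'' d)
      \<otimes>\<^bsub>eg_der_group L (m + n + p)\<^esub> eg_der_bracket L p (m + n) d'' (eg_der_bracket L m n d d')) i a =
      \<one>\<^bsub>eg_der_group L (m + n + p)\<^esub> i a"
      apply (simp add: S)
      apply (rule denotes_unique, ((rule denotes_intros | simp add: assms add_ac; fail)+)[3],
        simp add: algebra_simps)
      done
  qed (use c assms eg_der_mult eg_der_one in simp_all)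
qed

section \<open>The automorphism group and its action on derivations\<close>

text \<open>
  Families are extensional, so inverses and composites in the automorphism group are restrictions
  of the evident families; this lemma transports the morphism axioms to them.
\<close>

lemma eg_lie_hom_cong:
  assumes f: "eg_lie_hom L M f" and eq: "\<And>i x. x \<in> C i \<Longrightarrow> f' i x = f i x"
  shows "eg_lie_hom L M f'"
proof -
  interpret f: eg_lie_hom L M f by fact
  have "f' i \<in> hom (P i) (egl_part M i)" for i
    using f.part_hom[of i] eq by (auto simp: hom_def)
  then show ?thesis
    using f.map_bracket f.map_act
    by (intro eg_lie_hom.intro eg_lie_hom_axioms.intro f.L'.eg_lie_algebra_axioms eg_lie_algebra_axioms)
     (simp_all add: eq Suc_le_eq)
qed

lemma eg_lie_hom_id: "eg_lie_hom L L (\<lambda>i x. x)"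
  by (intro eg_lie_hom.intro eg_lie_hom_axioms.intro eg_lie_algebra_axioms) (auto simp: hom_def)

lemma eg_lie_hom_comp:
  assumes "eg_lie_hom L L f" "eg_lie_hom L L g"
  shows "eg_lie_hom L L (\<lambda>i x. f i (g i x))"
proof -
  interpret f: eg_lie_hom L L f by fact
  interpret g: eg_lie_hom L L g by fact
  have c: "\<And>i x. x \<in> C i \<Longrightarrow> g i x \<in> C i"
    using g.part_hom by (auto simp: hom_def)
  have "(\<lambda>x. f i (g i x)) \<in> hom (P i) (P i)" for i
    using f.part_hom[of i] g.part_hom[of i] by (auto simp: hom_def)
  then show ?thesis
    by (intro eg_lie_hom.intro eg_lie_hom_axioms.intro eg_lie_algebra_axioms)
     (simp_all add: c f.map_bracket g.map_bracket f.map_act g.map_act)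
qed

lemma eg_autI:
  assumes "\<And>i. f i \<in> extensional (C i)" "eg_lie_hom L L f" "eg_lie_hom L L g"
    "\<And>i x. x \<in> C i \<Longrightarrow> g i (f i x) = x" "\<And>i x. x \<in> C i \<Longrightarrow> f i (g i x) = x"
  shows "f \<in> eg_aut L"
  using assms by (auto simp: eg_aut_def)

abbreviation "inverse_family f \<equiv> \<lambda>i. \<lambda>x\<in>C i. inv_into (C i) (f i) x"

lemma eg_aut_inverse:
  assumes "f \<in> eg_aut L"
  shows eg_aut_inv_right: "x \<in> C i \<Longrightarrow> f i (inv_into (C i) (f i) x) = x"
    and eg_aut_inv_left: "x \<in> C i \<Longrightarrow> inv_into (C i) (f i) (f i x) = x"
    and eg_aut_inverse_family: "inverse_family f \<in> eg_aut L"
proof -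
  obtain g where f: "eg_lie_hom L L f" and g: "eg_lie_hom L L g"
    and fg: "\<And>i x. x \<in> C i \<Longrightarrow> g i (f i x) = x" "\<And>i x. x \<in> C i \<Longrightarrow> f i (g i x) = x"
    using assms by (auto simp: eg_aut_def)
  interpret f: eg_lie_hom L L f by fact
  interpret g: eg_lie_hom L L g by fact
  have fc: "f i x \<in> C i" if "x \<in> C i" for i x
    using f.part_hom that by (auto simp: hom_def)
  have gc: "g i x \<in> C i" if "x \<in> C i" for i x
    using g.part_hom that by (auto simp: hom_def)
  have inj: "inj_on (f i) (C i)" for i
    by (metis fg(1) inj_onI)
  have inv: "inv_into (C i) (f i) x = g i x" if "x \<in> C i" for i x
    using inv_into_f_f[OF inj gc] fg(2) that by metis
  show "x \<in> C i \<Longrightarrow> f i (inv_into (C i) (f i) x) = x"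
    by (simp add: inv fg)
  show "x \<in> C i \<Longrightarrow> inv_into (C i) (f i) (f i x) = x"
    by (simp add: inj)
  show "inverse_family f \<in> eg_aut L"
    by (rule eg_autI[OF _ eg_lie_hom_cong[OF g] f]) (simp_all add: inv fg fc)
qed

end

locale eg_automorphism = eg_lie_algebra L for L :: "'a eg_lie" +
  fixes f :: "nat \<Rightarrow> 'a \<Rightarrow> 'a"
  assumes aut: "f \<in> eg_aut L"
begin

sublocale f: eg_lie_hom L L f
  using aut by (simp add: eg_aut_def)

lemma f_ext [simp]: "f i \<in> extensional (C i)"
  using aut by (simp add: eg_aut_def)

lemma f_closed [simp]: "x \<in> C i \<Longrightarrow> f i x \<in> C i"
  using f.part_hom by (auto simp: hom_def)

lemma f_group_hom: "group_hom (P i) (P i) (f i)"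
  using f.part_hom by (simp add: group_hom_def group_hom_axioms_def)

lemma f_linear:
  "\<lbrakk>x \<in> C i; y \<in> C i\<rbrakk> \<Longrightarrow> f i (x \<otimes>\<^bsub>P i\<^esub> y) = f i x \<otimes>\<^bsub>P i\<^esub> f i y"
  "x \<in> C i \<Longrightarrow> f i (inv\<^bsub>P i\<^esub> x) = inv\<^bsub>P i\<^esub> (f i x)"
  using group_hom.hom_mult[OF f_group_hom] group_hom.hom_inv[OF f_group_hom] by blast+

lemma f_br:
  "\<lbrakk>0 < m; 0 < n; x \<in> C m; y \<in> C n; k = m + n\<rbrakk> \<Longrightarrow>
    f k (br m n x y) = br m n (f m x) (f n y)"
  using f.map_bracket[of m n x y] by simp

lemma f_act: "\<lbrakk>0 < m; g \<in> C 0; x \<in> C m\<rbrakk> \<Longrightarrow> f m (act m g x) = act m (f 0 g) (f m x)"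
  using f.map_act[of m g x] by simp

end

context eg_lie_algebra
begin

lemma eg_automorphismI: "f \<in> eg_aut L \<Longrightarrow> eg_automorphism L f"
  by (simp add: eg_automorphism_def eg_automorphism_axioms_def eg_lie_algebra_axioms)

lemma eg_aut_group_group: "group (eg_aut_group L)"
proof (rule groupI)
  fix f g assume "f \<in> carrier (eg_aut_group L)" "g \<in> carrier (eg_aut_group L)"
  then have fg: "f \<in> eg_aut L" "g \<in> eg_aut L" by (auto simp: eg_aut_group_def)
  interpret f: eg_automorphism L f using fg by (intro eg_automorphismI)
  interpret g: eg_automorphism L g using fg by (intro eg_automorphismI)
  interpret f': eg_automorphism L "inverse_family f"
    using fg by (intro eg_automorphismI eg_aut_inverse_family)
  interpret g': eg_automorphism L "inverse_family g"
    using fg by (intro eg_automorphismI eg_aut_inverse_family)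
  have c: "inv_into (C i) (f i) x \<in> C i" "inv_into (C i) (g i) x \<in> C i" if "x \<in> C i" for i x
    using f'.f_closed[of x i] g'.f_closed[of x i] that by simp_all
  have "(\<lambda>i. compose (C i) (f i) (g i)) \<in> eg_aut L"
    by (rule eg_autI[OF _ eg_lie_hom_cong[OF eg_lie_hom_comp[OF f.f.eg_lie_hom_axioms g.f.eg_lie_hom_axioms]]
       eg_lie_hom_comp[OF g'.f.eg_lie_hom_axioms f'.f.eg_lie_hom_axioms]])
     (simp_all add: compose_def c eg_aut_inv_left eg_aut_inv_right fg)
  then show "f \<otimes>\<^bsub>eg_aut_group L\<^esub> g \<in> carrier (eg_aut_group L)"
    by (simp add: eg_aut_group_def)
  fix h assume "h \<in> carrier (eg_aut_group L)"
  then interpret h: eg_automorphism L h by (intro eg_automorphismI) (simp add: eg_aut_group_def)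
  show "f \<otimes>\<^bsub>eg_aut_group L\<^esub> g \<otimes>\<^bsub>eg_aut_group L\<^esub> h = f \<otimes>\<^bsub>eg_aut_group L\<^esub> (g \<otimes>\<^bsub>eg_aut_group L\<^esub> h)"
    by (auto simp: eg_aut_group_def compose_def intro!: ext)
next
  show "\<one>\<^bsub>eg_aut_group L\<^esub> \<in> carrier (eg_aut_group L)"
    using eg_autI[OF _ eg_lie_hom_cong[OF eg_lie_hom_id] eg_lie_hom_id, of "\<lambda>i. \<lambda>x\<in>C i. x"]
    by (simp add: eg_aut_group_def)
next
  fix f assume "f \<in> carrier (eg_aut_group L)"
  then have f: "f \<in> eg_aut L" by (auto simp: eg_aut_group_def)
  interpret f: eg_automorphism L f using f by (intro eg_automorphismI)
  show "\<one>\<^bsub>eg_aut_group L\<^esub> \<otimes>\<^bsub>eg_aut_group L\<^esub> f = f"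
    by (auto simp: eg_aut_group_def compose_def intro!: ext simp: extensional_arb[OF f.f_ext])
  show "\<exists>g\<in>carrier (eg_aut_group L). g \<otimes>\<^bsub>eg_aut_group L\<^esub> f = \<one>\<^bsub>eg_aut_group L\<^esub>"
    by (rule bexI[of _ "inverse_family f"])
      (auto simp: eg_aut_group_def compose_def eg_aut_inv_left[OF f] eg_aut_inverse_family[OF f] intro!: ext)
qed

lemma eg_der_act_apply:
  "\<lbrakk>d \<in> eg_der L m; x \<in> C i\<rbrakk> \<Longrightarrow> eg_der_act L m f d i x = f (m + i) (d i (inv_into (C i) (f i) x))"
  by (simp add: eg_der_act_def)

text \<open>
  Conjugation by an automorphism transports every structure in sight, so each condition on
  $f d f^{-1}$ at $x$ is the $f$-image of the same condition on $d$ at $f^{-1}(x)$.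
\<close>

lemma eg_der_act_closed:
  assumes "0 < m" "f \<in> eg_aut L" "d \<in> eg_der L m"
  shows "eg_der_act L m f d \<in> eg_der L m"
proof -
  interpret f: eg_automorphism L f using assms by (intro eg_automorphismI)
  interpret f': eg_automorphism L "inverse_family f"
    using assms by (intro eg_automorphismI eg_aut_inverse_family)
  interpret d: eg_derivation L m d using assms by (intro eg_derivationI)
  define g where "g = inverse_family f"
  have inv: "x \<in> C i \<Longrightarrow> inv_into (C i) (f i) x = g i x" for i x by (simp add: g_def)
  interpret g: eg_automorphism L g unfolding g_def by unfold_locales
  have fg: "x \<in> C i \<Longrightarrow> f i (g i x) = x" for i x using eg_aut_inv_right[OF assms(2)] by (simp add: g_def)
  note S = eg_der_act_apply[OF assms(3)] inv fg f.f_linear g.f_linear f.f_br g.f_br f.f_act g.f_act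
    d.d_linear d.d_br d.d_mult d.d_act add_ac
  show ?thesis
    apply (rule eg_derI; (simp add: S)?)
     apply (simp_all add: eg_der_act_def assms)
    done
qed

lemma eg_der_act_mult:
  assumes "0 < m" "f \<in> eg_aut L" "d \<in> eg_der L m" "d' \<in> eg_der L m"
  shows "eg_der_act L m f (d \<otimes>\<^bsub>eg_der_group L m\<^esub> d') =
    eg_der_act L m f d \<otimes>\<^bsub>eg_der_group L m\<^esub> eg_der_act L m f d'"
proof -
  interpret f: eg_automorphism L f using assms by (intro eg_automorphismI)
  interpret f': eg_automorphism L "inverse_family f"
    using assms by (intro eg_automorphismI eg_aut_inverse_family)
  interpret d: eg_derivation L m d using assms by (intro eg_derivationI)
  interpret d': eg_derivation L m d' using assms by (intro eg_derivationI)
  have c: "inv_into (C i) (f i) x \<in> C i" if "x \<in> C i" for i x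
    using f'.f_closed[of x i] that by simp
  note dd' = eg_der_mult[OF assms(1,3,4)]
  have "eg_der_act L m f (d \<otimes>\<^bsub>eg_der_group L m\<^esub> d') i x =
    (eg_der_act L m f d \<otimes>\<^bsub>eg_der_group L m\<^esub> eg_der_act L m f d') i x" if "x \<in> C i" for i x
    using assms dd' that by (simp add: eg_der_act_apply eg_der_group_apply c f.f_linear)
  then show ?thesis
    by (intro eg_der_eqI[of _ m] eg_der_act_closed eg_der_mult assms) auto
qed

lemma eg_der_act_comp:
  assumes "0 < m" "f \<in> eg_aut L" "g \<in> eg_aut L" "d \<in> eg_der L m"
  shows "eg_der_act L m (f \<otimes>\<^bsub>eg_aut_group L\<^esub> g) d = eg_der_act L m f (eg_der_act L m g d)"
proof -
  interpret f: eg_automorphism L f using assms by (intro eg_automorphismI)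
  interpret g: eg_automorphism L g using assms by (intro eg_automorphismI)
  interpret f': eg_automorphism L "inverse_family f"
    using assms by (intro eg_automorphismI eg_aut_inverse_family)
  interpret g': eg_automorphism L "inverse_family g"
    using assms by (intro eg_automorphismI eg_aut_inverse_family)
  interpret d: eg_derivation L m d using assms by (intro eg_derivationI)
  have c: "inv_into (C i) (f i) x \<in> C i" "inv_into (C i) (g i) x \<in> C i" if "x \<in> C i" for i x
    using f'.f_closed[of x i] g'.f_closed[of x i] that by simp_all
  let ?h = "f \<otimes>\<^bsub>eg_aut_group L\<^esub> g"
  have h: "?h \<in> eg_aut L"
    using assms group.is_monoid[OF eg_aut_group_group] monoid.m_closed[of "eg_aut_group L" f g]
    by (simp add: eg_aut_group_def)
  have hx: "?h i x = f i (g i x)" if "x \<in> C i" for i x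
    using that by (simp add: eg_aut_group_def compose_eq)
  have inv: "inv_into (C i) (?h i) x = inv_into (C i) (g i) (inv_into (C i) (f i) x)" if "x \<in> C i" for i x
    using eg_aut_inv_left[OF h, of "inv_into (C i) (g i) (inv_into (C i) (f i) x)" i] that
    by (simp add: hx c eg_aut_inv_right assms)
  have "eg_der_act L m ?h d i x = eg_der_act L m f (eg_der_act L m g d) i x" if "x \<in> C i" for i x
    using assms that by (simp add: eg_der_act_apply eg_der_act_closed inv c hx)
  then show ?thesis
    by (intro eg_der_eqI[of _ m] eg_der_act_closed assms h) auto
qed

lemma eg_der_act_one:
  assumes "0 < m" "d \<in> eg_der L m"
  shows "eg_der_act L m \<one>\<^bsub>eg_aut_group L\<^esub> d = d"
proof -
  interpret d: eg_derivation L m d using assms by (intro eg_derivationI)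
  have one: "\<one>\<^bsub>eg_aut_group L\<^esub> \<in> eg_aut L"
    using group.is_monoid[OF eg_aut_group_group] monoid.one_closed[of "eg_aut_group L"]
    by (simp add: eg_aut_group_def)
  have "inv_into (C i) (\<one>\<^bsub>eg_aut_group L\<^esub> i) x = x" if "x \<in> C i" for i x
    using eg_aut_inv_left[OF one that] that by (simp add: eg_aut_group_def)
  then have "eg_der_act L m \<one>\<^bsub>eg_aut_group L\<^esub> d i x = d i x" if "x \<in> C i" for i x
    using assms that by (simp add: eg_der_act_apply) (simp add: eg_aut_group_def)
  then show ?thesis
    by (intro eg_der_eqI[of _ m] eg_der_act_closed assms one) auto
qed

lemma eg_der_act_hom:
  assumes "0 < m"
  shows "eg_der_act L m \<in> hom (eg_aut_group L) (AutoGroup (eg_der_group L m))"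
proof -
  interpret A: group "eg_aut_group L" by (rule eg_aut_group_group)
  have carr: "carrier (eg_aut_group L) = eg_aut L" by (simp add: eg_aut_group_def)
  have inv: "eg_der_act L m g (eg_der_act L m f d) = d"
    if "f \<in> eg_aut L" "g \<in> eg_aut L" "g \<otimes>\<^bsub>eg_aut_group L\<^esub> f = \<one>\<^bsub>eg_aut_group L\<^esub>" "d \<in> eg_der L m" for f g d
    using eg_der_act_comp[OF assms, of g f d] eg_der_act_one[OF assms, of d] that by simp
  have auto: "eg_der_act L m f \<in> auto (eg_der_group L m)" if f: "f \<in> eg_aut L" for f
  proof -
    define g where "g = inv\<^bsub>eg_aut_group L\<^esub> f"
    have g: "g \<in> eg_aut L" "g \<otimes>\<^bsub>eg_aut_group L\<^esub> f = \<one>\<^bsub>eg_aut_group L\<^esub>"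
      "f \<otimes>\<^bsub>eg_aut_group L\<^esub> g = \<one>\<^bsub>eg_aut_group L\<^esub>"
      using A.inv_closed[of f] A.l_inv[of f] A.r_inv[of f] f by (simp_all add: carr g_def)
    have "bij_betw (eg_der_act L m f) (eg_der L m) (eg_der L m)"
      by (rule bij_betw_byWitness[of _ "eg_der_act L m g"])
        (use f g inv eg_der_act_closed assms in auto)
    moreover have "eg_der_act L m f \<in> extensional (eg_der L m)"
      by (simp add: eg_der_act_def)
    ultimately show ?thesis
      using f assms by (auto simp: auto_def Bij_def hom_def eg_der_act_closed eg_der_act_mult)
  qed
  show ?thesis
  proof (rule homI)
    fix f assume "f \<in> carrier (eg_aut_group L)"
    then show "eg_der_act L m f \<in> carrier (AutoGroup (eg_der_group L m))"
      using auto by (simp add: carr AutoGroup_def)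
  next
    fix f g assume "f \<in> carrier (eg_aut_group L)" "g \<in> carrier (eg_aut_group L)"
    then have fg: "f \<in> eg_aut L" "g \<in> eg_aut L" by (simp_all add: carr)
    have "eg_der_act L m (f \<otimes>\<^bsub>eg_aut_group L\<^esub> g) = compose (eg_der L m) (eg_der_act L m f) (eg_der_act L m g)"
      by (rule extensionalityI[of _ "eg_der L m"])
        (auto simp: compose_eq eg_der_act_comp fg assms, simp add: eg_der_act_def)
    then show "eg_der_act L m (f \<otimes>\<^bsub>eg_aut_group L\<^esub> g) =
        eg_der_act L m f \<otimes>\<^bsub>AutoGroup (eg_der_group L m)\<^esub> eg_der_act L m g"
      using auto[OF fg(1)] auto[OF fg(2)] by (simp add: AutoGroup_def BijGroup_def auto_def)
  qed
qed

lemma eg_der_act_bracket: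
  assumes "0 < m" "0 < n" "f \<in> eg_aut L" "d \<in> eg_der L m" "d' \<in> eg_der L n"
  shows "eg_der_act L (m + n) f (eg_der_bracket L m n d d') =
    eg_der_bracket L m n (eg_der_act L m f d) (eg_der_act L n f d')"
proof -
  interpret f: eg_automorphism L f using assms by (intro eg_automorphismI)
  interpret f': eg_automorphism L "inverse_family f"
    using assms by (intro eg_automorphismI eg_aut_inverse_family)
  interpret d: eg_derivation L m d using assms by (intro eg_derivationI)
  interpret d': eg_derivation L n d' using assms by (intro eg_derivationI)
  have c: "inv_into (C i) (f i) x \<in> C i" if "x \<in> C i" for i x
    using f'.f_closed[of x i] that by simp
  note dd' = eg_der_bracket_closed[OF assms(1,2,4,5) refl]
  note S = assms dd' c eg_der_act_apply eg_der_act_closed eg_aut_inv_left f.f_linear f.f_br add_ac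
    eg_der_bracket_0 eg_der_bracket_pos
  show ?thesis
    by (rule eg_der_eqI[of _ "m + n"])
      (use assms dd' in \<open>simp_all add: eg_der_act_closed eg_der_bracket_closed, simp_all add: S\<close>)
qed

theorem eg_lie_algebra_Der: "eg_lie_algebra (Der L)"
proof (rule eg_lie_algebra.intro, unfold One_nat_def Suc_le_eq)
  show "Group.group (egl_part (Der L) 0)"
    by (simp add: Der_def eg_aut_group_group)
  show "comm_group (egl_part (Der L) m)" if "0 < m" for m
    using that by (simp add: Der_def eg_der_group_comm)
  show "(\<lambda>y. egl_bracket (Der L) m n x y) \<in> hom (egl_part (Der L) n) (egl_part (Der L) (m + n))"
    if "0 < m" "0 < n" "x \<in> carrier (egl_part (Der L) m)" for m n x
    using that eg_der_bracket_hom(1)[of m n x] by (simp add: Der_def)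
  show "(\<lambda>x. egl_bracket (Der L) m n x y) \<in> hom (egl_part (Der L) m) (egl_part (Der L) (m + n))"
    if "0 < m" "0 < n" "y \<in> carrier (egl_part (Der L) n)" for m n y
    using that eg_der_bracket_hom(2)[of n m y] by (simp add: Der_def)
  show "egl_bracket (Der L) m m x x = \<one>\<^bsub>egl_part (Der L) (m + m)\<^esub>"
    if "0 < m" "x \<in> carrier (egl_part (Der L) m)" for m x
    using that eg_der_bracket_self by (simp add: Der_def)
  show "egl_bracket (Der L) m n x y = inv\<^bsub>egl_part (Der L) (m + n)\<^esub> egl_bracket (Der L) n m y x"
    if "0 < m" "0 < n" "x \<in> carrier (egl_part (Der L) m)" "y \<in> carrier (egl_part (Der L) n)" for m n x y
    using that eg_der_bracket_anti[of m n x y] by (simp add: Der_def)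
  show "egl_bracket (Der L) m (n + p) x (egl_bracket (Der L) n p y z)
      \<otimes>\<^bsub>egl_part (Der L) (m + n + p)\<^esub> egl_bracket (Der L) n (p + m) y (egl_bracket (Der L) p m z x)
      \<otimes>\<^bsub>egl_part (Der L) (m + n + p)\<^esub> egl_bracket (Der L) p (m + n) z (egl_bracket (Der L) m n x y)
      = \<one>\<^bsub>egl_part (Der L) (m + n + p)\<^esub>"
    if "0 < m" "0 < n" "0 < p" "x \<in> carrier (egl_part (Der L) m)" "y \<in> carrier (egl_part (Der L) n)"
      "z \<in> carrier (egl_part (Der L) p)" for m n p x y z
    using that eg_der_jacobi[of m n p x y z] by (simp add: Der_def)
  show "egl_act (Der L) m \<in> hom (egl_part (Der L) 0) (AutoGroup (egl_part (Der L) m))" if "0 < m" for m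
    using that eg_der_act_hom by (simp add: Der_def)
  show "egl_act (Der L) (m + n) g (egl_bracket (Der L) m n x y) =
      egl_bracket (Der L) m n (egl_act (Der L) m g x) (egl_act (Der L) n g y)"
    if "0 < m" "0 < n" "g \<in> carrier (egl_part (Der L) 0)" "x \<in> carrier (egl_part (Der L) m)"
      "y \<in> carrier (egl_part (Der L) n)" for m n g x y
    using that eg_der_act_bracket[of m n g x y] by (simp add: Der_def eg_aut_group_def)
qed

end

section \<open>Congruences modulo a term of an extended N-series\<close>

context ext_N_series
begin

lemma term_antimono: "m \<le> n \<Longrightarrow> Ks n \<subseteq> Ks m"
  by (rule lift_Suc_antimono_le) (rule term_decreasing)

lemma term_mono_mem: "\<lbrakk>x \<in> Ks n; m \<le> n\<rbrakk> \<Longrightarrow> x \<in> Ks m"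
  using term_antimono by blast

lemma term_mult [simp]: "\<lbrakk>x \<in> Ks m; y \<in> Ks m\<rbrakk> \<Longrightarrow> x \<otimes> y \<in> Ks m"
  using subgroup.m_closed[OF term_subgroup] .

lemma term_inv [simp]: "x \<in> Ks m \<Longrightarrow> inv x \<in> Ks m"
  using subgroup.m_inv_closed[OF term_subgroup] .

lemma term_one [simp]: "\<one> \<in> Ks m"
  using subgroup.one_closed[OF term_subgroup] .

lemma term_conj [simp]: "\<lbrakk>a \<in> carrier K; x \<in> Ks m\<rbrakk> \<Longrightarrow> a \<otimes> x \<otimes> inv a \<in> Ks m"
  using normal.inv_op_closed2[OF term_normal] .

lemma commutator_closed [simp]:
  "\<lbrakk>a \<in> carrier K; b \<in> carrier K\<rbrakk> \<Longrightarrow> commutator K a b \<in> carrier K"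
  by (simp add: commutator_def)

lemma commutator_mem:
  "\<lbrakk>a \<in> Ks m; b \<in> Ks n; k \<le> m + n\<rbrakk> \<Longrightarrow> commutator K a b \<in> Ks k"
  using commutator_in term_mono_mem by blast

text \<open>
  Congruence modulo $K_N$, with membership in \<open>K\<close> included so that it is a partial equivalence
  relation for which products may be computed without side conditions.
\<close>

definition cong :: "nat \<Rightarrow> 'a \<Rightarrow> 'a \<Rightarrow> bool" where
  "cong N x y \<longleftrightarrow> x \<in> carrier K \<and> y \<in> carrier K \<and> Ks N #> x = Ks N #> y"

lemma cong_refl [simp]: "x \<in> carrier K \<Longrightarrow> cong N x x"
  by (simp add: cong_def)

lemma cong_sym: "cong N x y \<Longrightarrow> cong N y x"
  by (simp add: cong_def)

lemma cong_trans [trans]: "cong N x y \<Longrightarrow> cong N y z \<Longrightarrow> cong N x z"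
  by (simp add: cong_def)

lemma cong_mult: "\<lbrakk>cong N x y; cong N x' y'\<rbrakk> \<Longrightarrow> cong N (x \<otimes> x') (y \<otimes> y')"
  using normal.rcos_sum[OF term_normal[of N]] unfolding cong_def by (metis m_closed)

lemma cong_absorb: "\<lbrakk>h \<in> Ks p; N \<le> p; x \<in> carrier K\<rbrakk> \<Longrightarrow> cong N (h \<otimes> x) x"
  using coset_absorb[of h N x] term_mono_mem[of h p N] term_carrier by (simp add: cong_def)

lemma cong_one: "\<lbrakk>h \<in> Ks p; N \<le> p\<rbrakk> \<Longrightarrow> cong N h \<one>"
  using cong_absorb[of h p N \<one>] term_carrier by simp

text \<open>
  This and the next lemma are the source of all simplifications: $uxu^{-1}$ and $x$ differ
  by the commutator $[u, x] \in K_{p+q}$. For $p \ge 1$ and $N = q + 1$ conjugation by \<open>u\<close> can be ignored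
  modulo the next term of the series.
\<close>

lemma cong_conj:
  assumes "u \<in> Ks p" "x \<in> Ks q" "N \<le> p + q"
  shows "cong N (u \<otimes> x \<otimes> inv u) x"
proof -
  have c: "u \<in> carrier K" "x \<in> carrier K" using assms term_carrier by auto
  have "cong N (commutator K u x \<otimes> x) x"
    using commutator_in[OF assms(1,2)] assms c by (intro cong_absorb)
  also have "commutator K u x \<otimes> x = u \<otimes> x \<otimes> inv u"
    using c by (simp add: commutator_def m_assoc)
  finally show ?thesis .
qed

lemma cong_commute:
  assumes "u \<in> Ks p" "x \<in> Ks q" "N \<le> p + q"
  shows "cong N (u \<otimes> x) (x \<otimes> u)"
proof -
  have c: "u \<in> carrier K" "x \<in> carrier K" using assms term_carrier by auto
  have "cong N ((u \<otimes> x \<otimes> inv u) \<otimes> u) (x \<otimes> u)"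
    using cong_conj[OF assms] c by (intro cong_mult) simp_all
  then show ?thesis using c by (simp add: m_assoc)
qed

lemma cong_mem_iff: "x \<in> carrier K \<Longrightarrow> cong N x \<one> \<longleftrightarrow> x \<in> Ks N"
  using coset_join1 coset_join2 term_subgroup subgroup.subset[OF term_subgroup]
  by (auto simp: cong_def)

end

section \<open>Commutator calculus of an action\<close>

context ext_N_series_action
begin

abbreviation "acomm \<equiv> act_commutator K \<phi>"

lemma phi_auto: "g \<in> carrier G \<Longrightarrow> \<phi> g \<in> hom K K \<inter> Bij (carrier K)"
  using action_hom by (auto simp: hom_def AutoGroup_def auto_def)

lemma phi_group_hom: "g \<in> carrier G \<Longrightarrow> group_hom K K (\<phi> g)"
  using phi_auto by (simp add: group_hom_def group_hom_axioms_def K.group_axioms)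

lemma phi_closed [simp]: "\<lbrakk>g \<in> carrier G; a \<in> carrier K\<rbrakk> \<Longrightarrow> \<phi> g a \<in> carrier K"
  using group_hom.hom_closed[OF phi_group_hom] .

lemma phi_mult: "\<lbrakk>g \<in> carrier G; a \<in> carrier K; b \<in> carrier K\<rbrakk> \<Longrightarrow>
    \<phi> g (a \<otimes>\<^bsub>K\<^esub> b) = \<phi> g a \<otimes>\<^bsub>K\<^esub> \<phi> g b"
  using group_hom.hom_mult[OF phi_group_hom] .

lemma phi_inv: "\<lbrakk>g \<in> carrier G; a \<in> carrier K\<rbrakk> \<Longrightarrow> \<phi> g (inv\<^bsub>K\<^esub> a) = inv\<^bsub>K\<^esub> (\<phi> g a)"
  using group_hom.hom_inv[OF phi_group_hom] .

lemma phi_comp: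
  assumes "g \<in> carrier G" "h \<in> carrier G" "a \<in> carrier K"
  shows "\<phi> (g \<otimes>\<^bsub>G\<^esub> h) a = \<phi> g (\<phi> h a)"
proof -
  have "\<phi> (g \<otimes>\<^bsub>G\<^esub> h) = \<phi> g \<otimes>\<^bsub>AutoGroup K\<^esub> \<phi> h"
    using action_hom assms by (simp add: hom_mult)
  then show ?thesis
    using phi_auto assms by (simp add: AutoGroup_def BijGroup_def compose_eq)
qed

lemma phi_one:
  assumes "a \<in> carrier K"
  shows "\<phi> \<one>\<^bsub>G\<^esub> a = a"
proof -
  interpret p: group_hom G "AutoGroup K" \<phi>
    using action_hom K.AutoGroup by (simp add: group_hom_def group_hom_axioms_def G.group_axioms)
  show ?thesis using p.hom_one assms by (simp add: AutoGroup_def BijGroup_def)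
qed

lemma phi_inverse:
  assumes "g \<in> carrier G" "a \<in> carrier K"
  shows "\<phi> g (\<phi> (inv\<^bsub>G\<^esub> g) a) = a" "\<phi> (inv\<^bsub>G\<^esub> g) (\<phi> g a) = a"
  using phi_comp[of g "inv\<^bsub>G\<^esub> g" a] phi_comp[of "inv\<^bsub>G\<^esub> g" g a] phi_one assms by simp_all

lemma phi_commutator:
  "\<lbrakk>g \<in> carrier G; a \<in> carrier K; b \<in> carrier K\<rbrakk> \<Longrightarrow>
    \<phi> g (commutator K a b) = commutator K (\<phi> g a) (\<phi> g b)"
  by (simp add: commutator_def phi_mult phi_inv)

lemma acomm_closed [simp]: "\<lbrakk>g \<in> carrier G; a \<in> carrier K\<rbrakk> \<Longrightarrow> acomm g a \<in> carrier K"
  by (simp add: act_commutator_def)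

lemma phi_eq: "\<lbrakk>g \<in> carrier G; a \<in> carrier K\<rbrakk> \<Longrightarrow> \<phi> g a = acomm g a \<otimes>\<^bsub>K\<^esub> a"
  by (simp add: act_commutator_def K.m_assoc)

lemma acomm_mem: "\<lbrakk>g \<in> Gs m; a \<in> Ks n; k \<le> m + n\<rbrakk> \<Longrightarrow> acomm g a \<in> Ks k"
  using action_series K.term_mono_mem by blast

lemma phi_mem [simp]: "\<lbrakk>g \<in> carrier G; a \<in> Ks n\<rbrakk> \<Longrightarrow> \<phi> g a \<in> Ks n"
  using acomm_mem[of g 0 a n n] by (simp add: phi_eq G.term_0 K.term_carrier)

text \<open>
  The exact identities from which the congruences below are obtained. They hold for any action of a
  group on a group by automorphisms.
\<close>

lemma acomm_mult_right:
  "\<lbrakk>g \<in> carrier G; a \<in> carrier K; b \<in> carrier K\<rbrakk> \<Longrightarrow>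
    acomm g (a \<otimes>\<^bsub>K\<^esub> b) = acomm g a \<otimes>\<^bsub>K\<^esub> (a \<otimes>\<^bsub>K\<^esub> acomm g b \<otimes>\<^bsub>K\<^esub> inv\<^bsub>K\<^esub> a)"
  by (simp add: act_commutator_def phi_mult K.m_assoc K.inv_mult_group)

lemma acomm_mult_left:
  "\<lbrakk>g \<in> carrier G; h \<in> carrier G; a \<in> carrier K\<rbrakk> \<Longrightarrow>
    acomm (g \<otimes>\<^bsub>G\<^esub> h) a = acomm g (acomm h a) \<otimes>\<^bsub>K\<^esub> (acomm h a \<otimes>\<^bsub>K\<^esub> acomm g a)"
  by (simp add: act_commutator_def phi_comp phi_mult phi_inv K.m_assoc K.inv_mult_group)

lemma acomm_conj:
  assumes "g \<in> carrier G" "h \<in> carrier G" "a \<in> carrier K"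
  shows "acomm (g \<otimes>\<^bsub>G\<^esub> h \<otimes>\<^bsub>G\<^esub> inv\<^bsub>G\<^esub> g) (\<phi> g a) = \<phi> g (acomm h a)"
  using assms by (simp add: act_commutator_def phi_comp phi_inverse phi_mult phi_inv)

lemma acomm_mult_right_cong:
  assumes g: "g \<in> Gs m" and a: "a \<in> Ks i" and b: "b \<in> Ks j" and N: "N \<le> m + i + j"
  shows "K.cong N (acomm g (a \<otimes>\<^bsub>K\<^esub> b)) (acomm g a \<otimes>\<^bsub>K\<^esub> acomm g b)"
proof -
  have c: "g \<in> carrier G" "a \<in> carrier K" "b \<in> carrier K"
    using assms G.term_carrier K.term_carrier by auto
  have "K.cong N (a \<otimes>\<^bsub>K\<^esub> acomm g b \<otimes>\<^bsub>K\<^esub> inv\<^bsub>K\<^esub> a) (acomm g b)"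
    by (rule K.cong_conj[OF a action_series[OF g b]]) (use N in simp)
  then show ?thesis
    using c by (simp add: acomm_mult_right K.cong_mult)
qed

lemma acomm_mult_left_cong:
  assumes g: "g \<in> Gs m" and h: "h \<in> Gs n" and a: "a \<in> Ks i" and N: "N \<le> m + n + i"
  shows "K.cong N (acomm (g \<otimes>\<^bsub>G\<^esub> h) a) (acomm h a \<otimes>\<^bsub>K\<^esub> acomm g a)"
proof -
  have c: "g \<in> carrier G" "h \<in> carrier G" "a \<in> carrier K"
    using assms G.term_carrier K.term_carrier by auto
  show ?thesis
    unfolding acomm_mult_left[OF c]
    by (rule K.cong_absorb[OF action_series[OF g action_series[OF h a]]]) (use N c in simp_all)
qed

text \<open>
  With $u = [g,a]$ and $v = [g,b]$ the automorphism \<open>g\<close> sends \<open>a\<close> to \<open>ua\<close> and \<open>b\<close> to \<open>vb\<close>, hence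
  $[a,b]$ to $[ua, vb]$. Expanding the latter in both arguments gives, up to conjugations by \<open>u\<close>
  and \<open>v\<close>, the product of $[a,v]$, $[a,b]$, $[u,v]$ and $[u,b]$. The factor $[u,v]$ lies in degree
  $2m+i+j$, so it vanishes for $m \ge 1$. As $i, j \ge 1$, the conjugations can be ignored, and so can
  the one by $[a,b]$ that arises when $[a,b]$ is cancelled.
\<close>

lemma acomm_commutator_right:
  assumes g: "g \<in> Gs m" and a: "a \<in> Ks i" and b: "b \<in> Ks j" and pos: "0 < m" "0 < i" "0 < j"
  shows "K.cong (Suc (m + i + j)) (acomm g (commutator K a b))
    (commutator K (acomm g a) b \<otimes>\<^bsub>K\<^esub> commutator K a (acomm g b))"
proof -
  let ?N = "Suc (m + i + j)"
  define u where "u = acomm g a"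
  define v where "v = acomm g b"
  have u: "u \<in> Ks (m + i)" and v: "v \<in> Ks (m + j)"
    using action_series g a b by (simp_all add: u_def v_def)
  note mem = u v a b
  have c: "g \<in> carrier G" "a \<in> carrier K" "b \<in> carrier K" "u \<in> carrier K" "v \<in> carrier K"
    using g mem G.term_carrier K.term_carrier by auto
  let ?br = "commutator K"
  note in' = K.commutator_in[OF a v] K.commutator_in[OF a b] K.commutator_in[OF u v] K.commutator_in[OF u b]
  have 1: "K.cong ?N (?br a (v \<otimes>\<^bsub>K\<^esub> b)) (?br a v \<otimes>\<^bsub>K\<^esub> ?br a b)"
  proof -
    have "?br a (v \<otimes>\<^bsub>K\<^esub> b) = ?br a v \<otimes>\<^bsub>K\<^esub> (v \<otimes>\<^bsub>K\<^esub> ?br a b \<otimes>\<^bsub>K\<^esub> inv\<^bsub>K\<^esub> v)"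
      using c by (simp add: commutator_def K.m_assoc K.inv_mult_group)
    moreover have "K.cong ?N (v \<otimes>\<^bsub>K\<^esub> ?br a b \<otimes>\<^bsub>K\<^esub> inv\<^bsub>K\<^esub> v) (?br a b)"
      by (rule K.cong_conj[OF v in'(2)]) (use pos in simp)
    ultimately show ?thesis using c by (simp add: K.cong_mult)
  qed
  have 2: "K.cong ?N (?br u (v \<otimes>\<^bsub>K\<^esub> b)) (?br u b)"
  proof -
    have "?br u (v \<otimes>\<^bsub>K\<^esub> b) = ?br u v \<otimes>\<^bsub>K\<^esub> (v \<otimes>\<^bsub>K\<^esub> ?br u b \<otimes>\<^bsub>K\<^esub> inv\<^bsub>K\<^esub> v)"
      using c by (simp add: commutator_def K.m_assoc K.inv_mult_group)
    also have "K.cong ?N \<dots> (v \<otimes>\<^bsub>K\<^esub> ?br u b \<otimes>\<^bsub>K\<^esub> inv\<^bsub>K\<^esub> v)"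
      by (rule K.cong_absorb[OF in'(3)]) (use pos c in simp_all)
    also have "K.cong ?N \<dots> (?br u b)"
      by (rule K.cong_conj[OF v in'(4)]) (use pos in simp)
    finally show ?thesis .
  qed
  have vb: "v \<otimes>\<^bsub>K\<^esub> b \<in> Ks j"
    using v b K.term_mono_mem[of v "m + j" j] by simp
  have 3: "K.cong ?N (?br (u \<otimes>\<^bsub>K\<^esub> a) (v \<otimes>\<^bsub>K\<^esub> b)) ((?br a v \<otimes>\<^bsub>K\<^esub> ?br a b) \<otimes>\<^bsub>K\<^esub> ?br u b)"
  proof -
    have "?br (u \<otimes>\<^bsub>K\<^esub> a) (v \<otimes>\<^bsub>K\<^esub> b) =
        (u \<otimes>\<^bsub>K\<^esub> ?br a (v \<otimes>\<^bsub>K\<^esub> b) \<otimes>\<^bsub>K\<^esub> inv\<^bsub>K\<^esub> u) \<otimes>\<^bsub>K\<^esub> ?br u (v \<otimes>\<^bsub>K\<^esub> b)"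
      using c by (simp add: commutator_def K.m_assoc K.inv_mult_group)
    moreover have "K.cong ?N (u \<otimes>\<^bsub>K\<^esub> ?br a (v \<otimes>\<^bsub>K\<^esub> b) \<otimes>\<^bsub>K\<^esub> inv\<^bsub>K\<^esub> u) (?br a (v \<otimes>\<^bsub>K\<^esub> b))"
      by (rule K.cong_conj[OF u K.commutator_in[OF a vb]]) (use pos in simp)
    ultimately show ?thesis using K.cong_mult[OF K.cong_trans[OF _ 1] 2] by simp
  qed
  have "acomm g (?br a b) = ?br (u \<otimes>\<^bsub>K\<^esub> a) (v \<otimes>\<^bsub>K\<^esub> b) \<otimes>\<^bsub>K\<^esub> inv\<^bsub>K\<^esub> (?br a b)"
    using c phi_eq[of g a] phi_eq[of g b]
    by (simp add: act_commutator_def[of K \<phi> g "?br a b"] phi_commutator flip: u_def v_def)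
  also have "K.cong ?N \<dots> ((?br a v \<otimes>\<^bsub>K\<^esub> ?br a b) \<otimes>\<^bsub>K\<^esub> ?br u b \<otimes>\<^bsub>K\<^esub> inv\<^bsub>K\<^esub> (?br a b))"
    using 3 c by (intro K.cong_mult) simp_all
  also have "(?br a v \<otimes>\<^bsub>K\<^esub> ?br a b) \<otimes>\<^bsub>K\<^esub> ?br u b \<otimes>\<^bsub>K\<^esub> inv\<^bsub>K\<^esub> (?br a b) =
      ?br a v \<otimes>\<^bsub>K\<^esub> (?br a b \<otimes>\<^bsub>K\<^esub> ?br u b \<otimes>\<^bsub>K\<^esub> inv\<^bsub>K\<^esub> (?br a b))"
    using c by (simp add: K.m_assoc)
  also have "K.cong ?N \<dots> (?br a v \<otimes>\<^bsub>K\<^esub> ?br u b)"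
    using K.cong_conj[OF in'(2) in'(4), of ?N] pos c by (intro K.cong_mult) simp_all
  also have "K.cong ?N \<dots> (?br u b \<otimes>\<^bsub>K\<^esub> ?br a v)"
    by (rule K.cong_commute[OF in'(1) in'(4)]) (use pos in simp)
  finally show ?thesis by (simp add: u_def v_def)
qed

text \<open>
  With $x = [g,a]$, $y = a[g,b]a^{-1}$ and $z = aba^{-1}$ one has exactly
  $[g, z] = (x y x^{-1}) [x, z]$. Here $a$ has degree $0$, so only $m \ge 1$ allows one to drop the
  conjugation by \<open>x\<close> and to exchange the factors.
\<close>

lemma acomm_conj_right:
  assumes g: "g \<in> Gs m" and a: "a \<in> carrier K" and b: "b \<in> Ks i" and pos: "0 < m"
  shows "K.cong (Suc (m + i)) (acomm g (a \<otimes>\<^bsub>K\<^esub> b \<otimes>\<^bsub>K\<^esub> inv\<^bsub>K\<^esub> a))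
    (commutator K (acomm g a) (a \<otimes>\<^bsub>K\<^esub> b \<otimes>\<^bsub>K\<^esub> inv\<^bsub>K\<^esub> a) \<otimes>\<^bsub>K\<^esub> (a \<otimes>\<^bsub>K\<^esub> acomm g b \<otimes>\<^bsub>K\<^esub> inv\<^bsub>K\<^esub> a))"
proof -
  let ?N = "Suc (m + i)"
  define x where "x = acomm g a"
  define y where "y = a \<otimes>\<^bsub>K\<^esub> acomm g b \<otimes>\<^bsub>K\<^esub> inv\<^bsub>K\<^esub> a"
  define z where "z = a \<otimes>\<^bsub>K\<^esub> b \<otimes>\<^bsub>K\<^esub> inv\<^bsub>K\<^esub> a"
  have x: "x \<in> Ks m" and y: "y \<in> Ks (m + i)" and z: "z \<in> Ks i"
    using action_series[OF g, of a 0] action_series[OF g b] a b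
    by (simp_all add: x_def y_def z_def K.term_0)
  have c: "g \<in> carrier G" "b \<in> carrier K" "x \<in> carrier K" "y \<in> carrier K" "z \<in> carrier K"
    using g b x y z G.term_carrier K.term_carrier by auto
  have "acomm g z = (x \<otimes>\<^bsub>K\<^esub> y \<otimes>\<^bsub>K\<^esub> inv\<^bsub>K\<^esub> x) \<otimes>\<^bsub>K\<^esub> commutator K x z"
    using c a by (simp add: act_commutator_def x_def y_def z_def commutator_def phi_mult phi_inv
       K.m_assoc K.inv_mult_group)
  also have "K.cong ?N \<dots> (y \<otimes>\<^bsub>K\<^esub> commutator K x z)"
    using K.cong_conj[OF x y, of ?N] pos c by (intro K.cong_mult) simp_all
  also have "K.cong ?N \<dots> (commutator K x z \<otimes>\<^bsub>K\<^esub> y)"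
    by (rule K.cong_commute[OF y K.commutator_in[OF x z]]) (use pos in simp)
  finally show ?thesis by (simp add: x_def y_def z_def)
qed

text \<open>
  Evaluate both sides of $[g,h] \cdot hg = gh$ at \<open>a\<close>. With $x = [g,a]$, $y = [h,a]$, $k = [g,h]$ and
  $w = [h,x]xy$ they give $k(w)\,k(a) = [g,y]yxa$, and solving for $[k,a]$, up to factors of degree
  greater than $m+n+i$, yields $[k,a] \equiv [g,y]\,yxw^{-1} = [g,y]\,[x,y]^{-1}[h,x]^{-1}$. The
  correction $[x,y]$ has degree $m+n+2i$: it vanishes for $i \ge 1$ and is the extra term in the
  definition of the bracket of derivations for $i = 0$.
\<close>

lemma acomm_commutator_left:
  assumes g: "g \<in> Gs m" and h: "h \<in> Gs n" and a: "a \<in> Ks i" and pos: "0 < m" "0 < n"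
  shows "K.cong (Suc (m + n + i)) (acomm (commutator G g h) a)
    (acomm g (acomm h a) \<otimes>\<^bsub>K\<^esub> inv\<^bsub>K\<^esub> (acomm h (acomm g a)) \<otimes>\<^bsub>K\<^esub> inv\<^bsub>K\<^esub> (commutator K (acomm g a) (acomm h a)))"
proof -
  let ?N = "Suc (m + n + i)"
  define x where "x = acomm g a"
  define y where "y = acomm h a"
  define k where "k = commutator G g h"
  define w where "w = acomm h x \<otimes>\<^bsub>K\<^esub> x \<otimes>\<^bsub>K\<^esub> y"
  have x: "x \<in> Ks (m + i)" and y: "y \<in> Ks (n + i)"
    using action_series g h a by (simp_all add: x_def y_def)
  have k: "k \<in> Gs (m + n)"
    using G.commutator_in[OF g h] by (simp add: k_def)
  \<comment> \<open>As \<open>m\<close> and \<open>n\<close> are positive, \<open>w\<close> is deep enough for conjugation by it to be ignored at \<open>[k,a]\<close>.\<close>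
  have w: "w \<in> Ks (Suc i)"
    using K.term_mono_mem[OF x, of "Suc i"] K.term_mono_mem[OF y, of "Suc i"]
      K.term_mono_mem[OF action_series[OF h x], of "Suc i"] pos
    by (simp add: w_def)
  have c: "g \<in> carrier G" "h \<in> carrier G" "k \<in> carrier G" "a \<in> carrier K" "x \<in> carrier K"
    "y \<in> carrier K" "w \<in> carrier K"
    using g h k a x y w G.term_carrier K.term_carrier by auto
  have gh: "k \<otimes>\<^bsub>G\<^esub> (h \<otimes>\<^bsub>G\<^esub> g) = g \<otimes>\<^bsub>G\<^esub> h"
    using c by (simp add: k_def commutator_def G.m_assoc)
  have "\<phi> (h \<otimes>\<^bsub>G\<^esub> g) a = w \<otimes>\<^bsub>K\<^esub> a"
    using c by (simp add: phi_comp phi_eq[of g a] phi_mult phi_eq[of h] flip: x_def y_def)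
      (simp add: w_def K.m_assoc)
  moreover have "\<phi> (g \<otimes>\<^bsub>G\<^esub> h) a = acomm g y \<otimes>\<^bsub>K\<^esub> y \<otimes>\<^bsub>K\<^esub> x \<otimes>\<^bsub>K\<^esub> a"
    using c by (simp add: phi_comp phi_eq[of h a] phi_mult phi_eq[of g] K.m_assoc flip: x_def y_def)
  ultimately have "acomm k w \<otimes>\<^bsub>K\<^esub> w \<otimes>\<^bsub>K\<^esub> (acomm k a \<otimes>\<^bsub>K\<^esub> a) = acomm g y \<otimes>\<^bsub>K\<^esub> y \<otimes>\<^bsub>K\<^esub> x \<otimes>\<^bsub>K\<^esub> a"
    using c phi_comp[of k "h \<otimes>\<^bsub>G\<^esub> g" a] by (simp add: gh phi_mult phi_eq[of k])
  then have eq: "acomm k w \<otimes>\<^bsub>K\<^esub> (w \<otimes>\<^bsub>K\<^esub> acomm k a \<otimes>\<^bsub>K\<^esub> inv\<^bsub>K\<^esub> w) = acomm g y \<otimes>\<^bsub>K\<^esub> y \<otimes>\<^bsub>K\<^esub> x \<otimes>\<^bsub>K\<^esub> inv\<^bsub>K\<^esub> w"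
    using c by (simp flip: K.m_assoc)
  have "K.cong ?N (acomm k a) (w \<otimes>\<^bsub>K\<^esub> acomm k a \<otimes>\<^bsub>K\<^esub> inv\<^bsub>K\<^esub> w)"
    by (rule K.cong_sym, rule K.cong_conj[OF w action_series[OF k a]]) simp
  also have "K.cong ?N \<dots> (acomm k w \<otimes>\<^bsub>K\<^esub> (w \<otimes>\<^bsub>K\<^esub> acomm k a \<otimes>\<^bsub>K\<^esub> inv\<^bsub>K\<^esub> w))"
    by (rule K.cong_sym, rule K.cong_absorb[OF action_series[OF k w]]) (use c in simp_all)
  also have "\<dots> = acomm g y \<otimes>\<^bsub>K\<^esub> (inv\<^bsub>K\<^esub> (commutator K x y) \<otimes>\<^bsub>K\<^esub> inv\<^bsub>K\<^esub> (acomm h x))"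
    unfolding eq using c by (simp add: w_def commutator_def K.m_assoc K.inv_mult_group)
  also have "K.cong ?N \<dots> (acomm g y \<otimes>\<^bsub>K\<^esub> (inv\<^bsub>K\<^esub> (acomm h x) \<otimes>\<^bsub>K\<^esub> inv\<^bsub>K\<^esub> (commutator K x y)))"
    using K.commutator_in[OF x y] action_series[OF h x] pos c
    by (intro K.cong_mult K.cong_refl K.cong_commute[of _ "m + i + (n + i)" _ "n + (m + i)"]) simp_all
  finally show ?thesis using c by (simp add: x_def y_def k_def K.m_assoc)
qed

end

section \<open>The eg-Lie algebra of an extended N-series\<close>

context ext_N_series
begin

abbreviation "cls m a \<equiv> Ks (Suc m) #> a"

lemma cls_eq_iff: "\<lbrakk>x \<in> carrier K; y \<in> carrier K\<rbrakk> \<Longrightarrow> cls m x = cls m y \<longleftrightarrow> cong (Suc m) x y"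
  by (simp add: cong_def)

lemma cls_eqI: "cong (Suc m) x y \<Longrightarrow> cls m x = cls m y"
  by (simp add: cong_def)

lemma gr_carrier: "carrier (egl_part (gr K Ks) m) = cls m ` Ks m"
  by (simp add: gr_def gr_part_carrier)

lemma cls_closed [simp]: "a \<in> Ks m \<Longrightarrow> cls m a \<in> carrier (egl_part (gr K Ks) m)"
  by (simp add: gr_carrier)

lemma gr_mult [simp]:
  "\<lbrakk>a \<in> Ks m; b \<in> Ks m\<rbrakk> \<Longrightarrow> cls m a \<otimes>\<^bsub>egl_part (gr K Ks) m\<^esub> cls m b = cls m (a \<otimes> b)"
  using normal.rcos_sum[OF term_normal, of a b "Suc m"] term_carrier
  by (simp add: gr_def gr_part_def)

lemma gr_one: "\<one>\<^bsub>egl_part (gr K Ks) m\<^esub> = cls m \<one>"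
  using subgroup.subset[OF term_subgroup] by (simp add: gr_def gr_part_def)

lemma gr_group [simp]: "group (egl_part (gr K Ks) m)"
proof -
  have "Ks (Suc m) \<lhd> K\<lparr>carrier := Ks m\<rparr>"
    by (rule normal_restrict_supergroup[OF term_subgroup term_normal term_decreasing])
  then show ?thesis
    using normal.factorgroup_is_group by (simp add: gr_def gr_part_def)
qed

lemma gr_inv [simp]: "a \<in> Ks m \<Longrightarrow> inv\<^bsub>egl_part (gr K Ks) m\<^esub> (cls m a) = cls m (inv a)"
  by (rule group.inv_equality) (simp_all add: gr_one term_carrier)

lemma gr_comm_group: "0 < m \<Longrightarrow> comm_group (egl_part (gr K Ks) m)"
  by (rule group.group_comm_groupI)
    (auto simp: gr_carrier cls_eq_iff term_carrier intro!: cong_commute[of _ m _ m] del: equalityI)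

lemma gr_act_cls [simp]:
  "\<lbrakk>a \<in> carrier K; b \<in> Ks m\<rbrakk> \<Longrightarrow> egl_act (gr K Ks) m (cls 0 a) (cls m b) = cls m (a \<otimes> b \<otimes> inv a)"
  using gr_act_coset by simp

lemma gr_bracket_cls [simp]:
  "\<lbrakk>a \<in> Ks m; b \<in> Ks n\<rbrakk> \<Longrightarrow>
    egl_bracket (gr K Ks) m n (cls m a) (cls n b) = cls (m + n) (commutator K a b)"
  by (rule gr_bracket_coset)

definition conjugation :: "'a \<Rightarrow> 'a \<Rightarrow> 'a" where
  "conjugation g = (\<lambda>k\<in>carrier K. g \<otimes> k \<otimes> inv g)"

lemma conjugation_commutator:
  "\<lbrakk>g \<in> carrier K; k \<in> carrier K\<rbrakk> \<Longrightarrow> act_commutator K conjugation g k = commutator K g k"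
  by (simp add: act_commutator_def conjugation_def commutator_def)

text \<open>
  Through this action, the commutator calculus of actions specializes to that of \<open>K\<close> itself.
\<close>

lemma conjugation_action: "ext_N_series_action K Ks K Ks conjugation"
proof -
  have auto: "conjugation g \<in> auto K" if g: "g \<in> carrier K" for g
  proof -
    have "bij_betw (conjugation g) (carrier K) (carrier K)"
      by (rule bij_betw_byWitness[of _ "conjugation (inv g)"])
        (use g in \<open>auto simp: conjugation_def m_assoc\<close>)
    then show ?thesis
      using g by (auto simp: auto_def Bij_def hom_def conjugation_def m_assoc)
  qed
  have "conjugation \<in> hom K (AutoGroup K)"
  proof (rule homI)
    fix g h assume gh: "g \<in> carrier K" "h \<in> carrier K"
    have "conjugation (g \<otimes> h) = compose (carrier K) (conjugation g) (conjugation h)"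
      using gh by (auto simp: conjugation_def compose_def m_assoc inv_mult_group intro!: ext)
    then show "conjugation (g \<otimes> h) = conjugation g \<otimes>\<^bsub>AutoGroup K\<^esub> conjugation h"
      using auto gh by (simp add: AutoGroup_def BijGroup_def auto_def)
  qed (use auto in \<open>simp add: AutoGroup_def\<close>)
  then show ?thesis
    by unfold_locales
      (use commutator_in conjugation_commutator term_carrier in \<open>auto simp: conjugation_commutator\<close>)
qed

lemma commutator_right_cong:
  assumes "a \<in> Ks m" "b \<in> Ks n" "c \<in> Ks n" "0 < n"
  shows "cong (Suc (m + n)) (commutator K a (b \<otimes> c)) (commutator K a b \<otimes> commutator K a c)"
proof -
  interpret conj: ext_N_series_action K Ks K Ks conjugation by (rule conjugation_action)
  show ?thesis
    using conj.acomm_mult_right_cong[OF assms(1,2,3), of "Suc (m + n)"] assms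
    by (simp add: conjugation_commutator term_carrier)
qed

lemma commutator_left_cong:
  assumes "a \<in> Ks m" "b \<in> Ks m" "c \<in> Ks n" "0 < m"
  shows "cong (Suc (m + n)) (commutator K (a \<otimes> b) c) (commutator K a c \<otimes> commutator K b c)"
proof -
  interpret conj: ext_N_series_action K Ks K Ks conjugation by (rule conjugation_action)
  have "cong (Suc (m + n)) (commutator K (a \<otimes> b) c) (commutator K b c \<otimes> commutator K a c)"
    using conj.acomm_mult_left_cong[OF assms(1,2,3), of "Suc (m + n)"] assms
    by (simp add: conjugation_commutator term_carrier)
  also have "cong (Suc (m + n)) \<dots> (commutator K a c \<otimes> commutator K b c)"
    using assms commutator_in by (intro cong_commute[of _ "m + n" _ "m + n"]) simp_all
  finally show ?thesis .
qed

lemma commutator_inv_right_cong: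
  assumes "a \<in> Ks m" "b \<in> Ks n" "0 < n"
  shows "cong (Suc (m + n)) (commutator K a (inv b)) (inv (commutator K a b))"
proof -
  have c: "a \<in> carrier K" "b \<in> carrier K" using assms term_carrier by auto
  have "commutator K a (inv b) = inv b \<otimes> inv (commutator K a b) \<otimes> inv (inv b)"
    using c by (simp add: commutator_def m_assoc inv_mult_group)
  also have "cong (Suc (m + n)) \<dots> (inv (commutator K a b))"
    by (rule cong_conj[of _ n _ "m + n"]) (use assms commutator_in in simp_all)
  finally show ?thesis .
qed

text \<open>
  The Leibniz rule for conjugation by \<open>x\<close> reads $[x,[y,z]] \equiv [[x,y],z]\,[y,[x,z]]$; the two
  other summands of the Jacobi identity are, up to congruence, the inverses of these factors.
\<close>

lemma commutator_jacobi_cong: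
  assumes x: "x \<in> Ks m" and y: "y \<in> Ks n" and z: "z \<in> Ks p" and pos: "0 < m" "0 < n" "0 < p"
  shows "cong (Suc (m + n + p))
    (commutator K x (commutator K y z) \<otimes> commutator K y (commutator K z x) \<otimes>
      commutator K z (commutator K x y)) \<one>"
proof -
  interpret conj: ext_N_series_action K Ks K Ks conjugation by (rule conjugation_action)
  let ?N = "Suc (m + n + p)" and ?br = "commutator K"
  have c: "x \<in> carrier K" "y \<in> carrier K" "z \<in> carrier K" using x y z term_carrier by auto
  have 1: "cong ?N (?br x (?br y z)) (?br (?br x y) z \<otimes> ?br y (?br x z))"
    using conj.acomm_commutator_right[OF x y z pos] c by (simp add: conjugation_commutator)
  have "?br y (?br z x) = ?br y (inv (?br x z))"
    using c by (simp add: commutator_inv)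
  also have "cong ?N \<dots> (inv (?br y (?br x z)))"
    using commutator_inv_right_cong[OF y commutator_in[OF x z]] pos by (simp add: add_ac)
  finally have 2: "cong ?N (?br y (?br z x)) (inv (?br y (?br x z)))" .
  have 3: "?br z (?br x y) = inv (?br (?br x y) z)"
    using c by (simp add: commutator_inv)
  have "cong ?N (?br x (?br y z) \<otimes> ?br y (?br z x) \<otimes> ?br z (?br x y))
    (?br (?br x y) z \<otimes> ?br y (?br x z) \<otimes> inv (?br y (?br x z)) \<otimes> inv (?br (?br x y) z))"
    using 1 2 c unfolding 3 by (intro cong_mult) simp_all
  then show ?thesis using c by (simp add: m_assoc)
qed

lemma commutator_self: "a \<in> carrier K \<Longrightarrow> commutator K a a = \<one>"
  by (simp add: commutator_def m_assoc)

lemma conj_mult: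
  "\<lbrakk>a \<in> carrier K; x \<in> Ks m; y \<in> Ks m\<rbrakk> \<Longrightarrow>
    a \<otimes> (x \<otimes> y) \<otimes> inv a = (a \<otimes> x \<otimes> inv a) \<otimes> (a \<otimes> y \<otimes> inv a)"
  by (simp add: term_carrier m_assoc)

lemma conj_conj:
  "\<lbrakk>a \<in> carrier K; b \<in> carrier K; x \<in> Ks m\<rbrakk> \<Longrightarrow>
    (a \<otimes> b) \<otimes> x \<otimes> inv (a \<otimes> b) = a \<otimes> (b \<otimes> x \<otimes> inv b) \<otimes> inv a"
  by (simp add: term_carrier m_assoc inv_mult_group)

lemma conj_commutator:
  "\<lbrakk>a \<in> carrier K; x \<in> Ks m; y \<in> Ks n\<rbrakk> \<Longrightarrow>
    a \<otimes> commutator K x y \<otimes> inv a = commutator K (a \<otimes> x \<otimes> inv a) (a \<otimes> y \<otimes> inv a)"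
  by (simp add: commutator_def term_carrier m_assoc inv_mult_group)

lemma gr_act_hom:
  assumes "0 < m"
  shows "egl_act (gr K Ks) m \<in> hom (egl_part (gr K Ks) 0) (AutoGroup (egl_part (gr K Ks) m))"
proof -
  let ?L = "gr K Ks" and ?C = "carrier (egl_part (gr K Ks) m)"
  have ext: "egl_act ?L m U \<in> extensional ?C" for U
    by (simp add: gr_def gr_act_def)
  have auto: "egl_act ?L m (cls 0 a) \<in> auto (egl_part ?L m)" if a: "a \<in> carrier K" for a
  proof -
    have act: "egl_act ?L m (cls 0 b) U \<in> ?C"
      "egl_act ?L m (cls 0 (inv b)) (egl_act ?L m (cls 0 b) U) = U"
      if b: "b \<in> carrier K" and U: "U \<in> ?C" for b U
    proof -
      obtain c where c: "c \<in> Ks m" "U = cls m c" using U by (auto simp: gr_carrier)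
      have "inv b \<otimes> (b \<otimes> c \<otimes> inv b) \<otimes> inv (inv b) = c"
        using b term_carrier[OF c(1)] by (simp add: m_assoc)
      then show "egl_act ?L m (cls 0 b) U \<in> ?C"
        "egl_act ?L m (cls 0 (inv b)) (egl_act ?L m (cls 0 b) U) = U"
        using b c by simp_all
    qed
    have "bij_betw (egl_act ?L m (cls 0 a)) ?C ?C"
      by (rule bij_betw_byWitness[of _ "egl_act ?L m (cls 0 (inv a))"])
        (use a act[of a] act[of "inv a"] in auto)
    then show ?thesis
      using a ext by (auto simp: auto_def Bij_def hom_def gr_carrier conj_mult del: equalityI)
  qed
  show ?thesis
  proof (rule homI)
    fix U V assume "U \<in> carrier (egl_part ?L 0)" "V \<in> carrier (egl_part ?L 0)"
    then obtain a b where ab: "a \<in> carrier K" "b \<in> carrier K" and UV: "U = cls 0 a" "V = cls 0 b"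
      by (auto simp: gr_carrier term_0)
    have "egl_act ?L m (U \<otimes>\<^bsub>egl_part ?L 0\<^esub> V) = compose ?C (egl_act ?L m U) (egl_act ?L m V)"
      by (rule extensionalityI[OF ext])
        (use ab in \<open>auto simp: UV gr_carrier[of m] compose_eq term_0 conj_conj del: equalityI\<close>)
    then show "egl_act ?L m (U \<otimes>\<^bsub>egl_part ?L 0\<^esub> V) =
        egl_act ?L m U \<otimes>\<^bsub>AutoGroup (egl_part ?L m)\<^esub> egl_act ?L m V"
      using auto ab UV by (simp add: AutoGroup_def BijGroup_def auto_def)
  qed (use auto in \<open>auto simp: AutoGroup_def gr_carrier term_0\<close>)
qed

theorem eg_lie_algebra_gr: "eg_lie_algebra (gr K Ks)"
proof (rule eg_lie_algebra.intro, unfold One_nat_def Suc_le_eq)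
  let ?L = "gr K Ks"
  note S = gr_carrier term_carrier commutator_in
  show "Group.group (egl_part ?L 0)" by simp
  show "comm_group (egl_part ?L m)" if "0 < m" for m
    using that by (rule gr_comm_group)
  show "(\<lambda>y. egl_bracket ?L m n x y) \<in> hom (egl_part ?L n) (egl_part ?L (m + n))"
    if "0 < m" "0 < n" "x \<in> carrier (egl_part ?L m)" for m n x
    using that by (auto intro!: homI commutator_right_cong simp: S cls_eq_iff del: equalityI)
  show "(\<lambda>x. egl_bracket ?L m n x y) \<in> hom (egl_part ?L m) (egl_part ?L (m + n))"
    if "0 < m" "0 < n" "y \<in> carrier (egl_part ?L n)" for m n y
    using that by (auto intro!: homI commutator_left_cong simp: S cls_eq_iff del: equalityI)
  show "egl_bracket ?L m m x x = \<one>\<^bsub>egl_part ?L (m + m)\<^esub>"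
    if "0 < m" "x \<in> carrier (egl_part ?L m)" for m x
    using that by (auto simp: S gr_one commutator_self del: equalityI)
  show "egl_bracket ?L m n x y = inv\<^bsub>egl_part ?L (m + n)\<^esub> egl_bracket ?L n m y x"
    if mem: "x \<in> carrier (egl_part ?L m)" "y \<in> carrier (egl_part ?L n)" for m n x y
  proof -
    obtain a b where ab: "a \<in> Ks m" "b \<in> Ks n" "x = cls m a" "y = cls n b"
      using mem by (auto simp: gr_carrier)
    have "commutator K b a \<in> Ks (m + n)"
      using commutator_in[OF ab(2,1)] by (simp add: add.commute)
    then show ?thesis
      using ab by (simp add: add.commute[of n m] commutator_inv term_carrier)
  qed
  show "egl_bracket ?L m (n + p) x (egl_bracket ?L n p y z)
      \<otimes>\<^bsub>egl_part ?L (m + n + p)\<^esub> egl_bracket ?L n (p + m) y (egl_bracket ?L p m z x)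
      \<otimes>\<^bsub>egl_part ?L (m + n + p)\<^esub> egl_bracket ?L p (m + n) z (egl_bracket ?L m n x y)
      = \<one>\<^bsub>egl_part ?L (m + n + p)\<^esub>"
    if pos: "0 < m" "0 < n" "0 < p" and mem: "x \<in> carrier (egl_part ?L m)" "y \<in> carrier (egl_part ?L n)"
      "z \<in> carrier (egl_part ?L p)" for m n p x y z
  proof -
    obtain a b c where abc: "a \<in> Ks m" "b \<in> Ks n" "c \<in> Ks p"
      and xyz: "x = cls m a" "y = cls n b" "z = cls p c"
      using mem by (auto simp: gr_carrier)
    have in': "commutator K a (commutator K b c) \<in> Ks (m + (n + p))"
      "commutator K b (commutator K c a) \<in> Ks (m + (n + p))"
      "commutator K c (commutator K a b) \<in> Ks (m + (n + p))"
      using abc by (auto intro: commutator_mem[OF _ commutator_in])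
    have eq: "n + (p + m) = m + (n + p)" "p + (m + n) = m + (n + p)" by simp_all
    show ?thesis
      using cls_eqI[OF commutator_jacobi_cong[OF abc pos]] abc in'
      by (simp add: xyz commutator_in gr_one add.assoc) (simp add: eq in')
  qed
  show "egl_act ?L m \<in> hom (egl_part ?L 0) (AutoGroup (egl_part ?L m))" if "0 < m" for m
    using that by (rule gr_act_hom)
  show "egl_act ?L (m + n) g (egl_bracket ?L m n x y) =
      egl_bracket ?L m n (egl_act ?L m g x) (egl_act ?L n g y)"
    if "0 < m" "0 < n" "g \<in> carrier (egl_part ?L 0)" "x \<in> carrier (egl_part ?L m)"
      "y \<in> carrier (egl_part ?L n)" for m n g x y
    using that by (auto simp: S term_0 conj_commutator del: equalityI)
qed

lemma cong_iff_diff: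
  assumes "x \<in> carrier K" "y \<in> carrier K"
  shows "cong N x y \<longleftrightarrow> x \<otimes> inv y \<in> Ks N"
proof
  assume "cong N x y"
  then have "cong N (x \<otimes> inv y) (y \<otimes> inv y)"
    using assms by (intro cong_mult) simp_all
  then show "x \<otimes> inv y \<in> Ks N" using assms by (simp add: cong_mem_iff)
next
  assume "x \<otimes> inv y \<in> Ks N"
  then have "cong N ((x \<otimes> inv y) \<otimes> y) y"
    using assms by (intro cong_absorb[of _ N]) simp_all
  then show "cong N x y" using assms by (simp add: m_assoc)
qed

lemma cls_eq_one_iff: "x \<in> Ks m \<Longrightarrow> cls m x = \<one>\<^bsub>egl_part (gr K Ks) m\<^esub> \<longleftrightarrow> x \<in> Ks (Suc m)"
  using cong_mem_iff[of x "Suc m"] by (simp add: gr_one cls_eq_iff term_carrier)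

lemma mem_cls:
  assumes "a \<in> Ks m"
  shows "a \<in> cls m a" "a' \<in> cls m a \<Longrightarrow> a' \<in> Ks m" "a' \<in> cls m a \<Longrightarrow> cls m a' = cls m a"
proof -
  show "a \<in> cls m a" using assms rcos_self term_subgroup term_carrier by blast
  assume a': "a' \<in> cls m a"
  then obtain x where x: "x \<in> Ks (Suc m)" "a' = x \<otimes> a" by (auto simp: r_coset_def)
  then show "a' \<in> Ks m" using assms subsetD[OF term_decreasing x(1)] by simp
  show "cls m a' = cls m a"
    using x assms by (simp add: coset_absorb term_carrier)
qed

end

section \<open>The morphism to derivations\<close>

context ext_N_series_action
begin

abbreviation "T \<equiv> tau K Ks \<phi>"

sublocale KL: eg_lie_algebra "gr K Ks"
  by (rule K.eg_lie_algebra_gr)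

text \<open>
  Independence of the representatives: changing \<open>g\<close> by an element of $G_{m+1}$ or \<open>a\<close> by an
  element of $K_{i+1}$ changes the value by a factor of degree at least $m+i+1$.
\<close>

lemma tau_rep_cong:
  assumes g: "g \<in> Gs m" and a: "a \<in> Ks i" and g': "g' \<in> G.cls m g" and a': "a' \<in> K.cls i a"
  shows "tau_rep K Ks \<phi> m g' i a' = tau_rep K Ks \<phi> m g i a"
proof -
  obtain z where z: "z \<in> Gs (Suc m)" and g'_eq: "g' = z \<otimes>\<^bsub>G\<^esub> g"
    using g' by (auto simp: r_coset_def)
  obtain k where k: "k \<in> Ks (Suc i)" and a'_eq: "a' = k \<otimes>\<^bsub>K\<^esub> a"
    using a' by (auto simp: r_coset_def)
  have g'_mem: "g' \<in> Gs m" using G.mem_cls(2)[OF g g'] .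
  have c: "g \<in> carrier G" "z \<in> carrier G" "g' \<in> carrier G" "a \<in> carrier K" "k \<in> carrier K"
    using g z g'_mem a k G.term_carrier K.term_carrier by auto
  show ?thesis
  proof (cases "m = 0")
    case True
    have "K.cong (Suc i) (\<phi> g' a') (\<phi> g' a)"
      unfolding a'_eq using c phi_mem[OF c(3) k] by (simp add: phi_mult) (rule K.cong_absorb[of _ "Suc i"]; simp)
    also have "\<phi> g' a = acomm z (\<phi> g a) \<otimes>\<^bsub>K\<^esub> \<phi> g a"
      using c by (simp add: g'_eq phi_comp phi_eq[of z])
    also have "K.cong (Suc i) \<dots> (\<phi> g a)"
      using action_series[OF z phi_mem[OF c(1) a]] c True by (intro K.cong_absorb[of _ "Suc i"]) simp_all
    finally show ?thesis using True by (simp add: tau_rep_def K.cls_eqI)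
  next
    case False
    have "K.cong (Suc (m + i)) (acomm g' a') (acomm g' k \<otimes>\<^bsub>K\<^esub> acomm g' a)"
      unfolding a'_eq by (rule acomm_mult_right_cong[OF g'_mem k a]) simp
    also have "K.cong (Suc (m + i)) \<dots> (acomm g' a)"
      by (rule K.cong_absorb[OF action_series[OF g'_mem k]]) (use c in simp_all)
    also have "K.cong (Suc (m + i)) (acomm g' a) (acomm g a \<otimes>\<^bsub>K\<^esub> acomm z a)"
      unfolding g'_eq by (rule acomm_mult_left_cong[OF z g a]) simp
    also have "K.cong (Suc (m + i)) \<dots> (acomm z a \<otimes>\<^bsub>K\<^esub> acomm g a)"
      by (rule K.cong_commute[OF action_series[OF g a] action_series[OF z a]]) simp
    also have "K.cong (Suc (m + i)) \<dots> (acomm g a)"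
      by (rule K.cong_absorb[OF action_series[OF z a]]) (use c in simp_all)
    finally show ?thesis using False by (simp add: tau_rep_def K.cls_eqI)
  qed
qed

lemma tau_cls:
  assumes "g \<in> Gs m" "a \<in> Ks i"
  shows "T m (G.cls m g) i (K.cls i a) = tau_rep K Ks \<phi> m g i a"
  using assms the_elem_representatives[OF G.mem_cls(1)[OF assms(1)] K.mem_cls(1)[OF assms(2)]
      tau_rep_cong[OF assms]]
  by (simp add: tau_def K.gr_part_carrier)

lemma tau_0_cls:
  "\<lbrakk>g \<in> carrier G; a \<in> Ks i\<rbrakk> \<Longrightarrow> T 0 (G.cls 0 g) i (K.cls i a) = K.cls i (\<phi> g a)"
  using tau_cls[of g 0 a i] by (simp add: tau_rep_def G.term_0)

lemma tau_pos_cls: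
  "\<lbrakk>0 < m; g \<in> Gs m; a \<in> Ks i\<rbrakk> \<Longrightarrow> T m (G.cls m g) i (K.cls i a) = K.cls (m + i) (acomm g a)"
  using tau_cls[of g m a i] by (simp add: tau_rep_def)

lemma tau_ext: "T m U i \<in> extensional (KL.C i)"
  by (simp add: tau_def gr_def)

text \<open>
  The conditions on a derivation are the congruences for $[g, -]$, except the one on
  $d_0(ab)$, which holds exactly: it is the identity $[g,ab] = [g,a]\cdot a[g,b]a^{-1}$.
\<close>

lemma tau_pos_closed:
  assumes m: "0 < m" and g: "g \<in> Gs m"
  shows "T m (G.cls m g) \<in> eg_der (gr K Ks) m"
proof (rule KL.eg_derI)
  note S = K.gr_carrier tau_pos_cls[OF m g] action_series[OF g]
  have gc: "g \<in> carrier G" using g G.term_carrier by blast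
  show "T m (G.cls m g) i \<in> extensional (KL.C i)" for i by (rule tau_ext)
  show "T m (G.cls m g) i x \<in> KL.C (m + i)" if "x \<in> KL.C i" for i x
    using that by (auto simp: S)
  show "T m (G.cls m g) i (x \<otimes>\<^bsub>KL.P i\<^esub> y) = T m (G.cls m g) i x \<otimes>\<^bsub>KL.P (m + i)\<^esub> T m (G.cls m g) i y"
    if "0 < i" "x \<in> KL.C i" "y \<in> KL.C i" for i x y
    using that by (auto simp: S intro!: K.cls_eqI acomm_mult_right_cong[OF g] del: equalityI)
  show "T m (G.cls m g) (i + j) (KL.br i j x y) =
      KL.br (m + i) j (T m (G.cls m g) i x) y \<otimes>\<^bsub>KL.P (m + i + j)\<^esub> KL.br i (m + j) x (T m (G.cls m g) j y)"
    if pos: "0 < i" "0 < j" and mem: "x \<in> KL.C i" "y \<in> KL.C j" for i j x y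
  proof -
    obtain a b where ab: "a \<in> Ks i" "b \<in> Ks j" "x = K.cls i a" "y = K.cls j b"
      using mem by (auto simp: K.gr_carrier)
    have "commutator K (acomm g a) b \<in> Ks (m + (i + j))" "commutator K a (acomm g b) \<in> Ks (m + (i + j))"
      using K.commutator_in[OF action_series[OF g ab(1)] ab(2)]
        K.commutator_in[OF ab(1) action_series[OF g ab(2)]] by (simp_all add: add_ac)
    then show ?thesis
      using ab K.cls_eqI[OF acomm_commutator_right[OF g ab(1,2) m pos]]
      by (simp add: S K.commutator_in add.assoc add.left_commute[of i m])
  qed
  show "T m (G.cls m g) 0 (x \<otimes>\<^bsub>KL.P 0\<^esub> y) =
      T m (G.cls m g) 0 x \<otimes>\<^bsub>KL.P m\<^esub> KL.act m x (T m (G.cls m g) 0 y)"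
    if mem: "x \<in> KL.C 0" "y \<in> KL.C 0" for x y
  proof -
    obtain a b where ab: "a \<in> Ks 0" "b \<in> Ks 0" "x = K.cls 0 a" "y = K.cls 0 b"
      using mem by (auto simp: K.gr_carrier)
    then show ?thesis
      using S(3)[of a 0] S(3)[of b 0] gc
      by (simp add: S(2) acomm_mult_right K.term_0)
  qed
  show "T m (G.cls m g) i (KL.act i a x) =
      KL.br m i (T m (G.cls m g) 0 a) (KL.act i a x) \<otimes>\<^bsub>KL.P (m + i)\<^esub> KL.act (m + i) a (T m (G.cls m g) i x)"
    if pos: "0 < i" and mem: "a \<in> KL.C 0" "x \<in> KL.C i" for i a x
  proof -
    obtain b c where bc: "b \<in> Ks 0" "c \<in> Ks i" "a = K.cls 0 b" "x = K.cls i c"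
      using mem by (auto simp: K.gr_carrier)
    then have b: "b \<in> carrier K" by (simp add: K.term_0)
    show ?thesis
      using bc b K.cls_eqI[OF acomm_conj_right[OF g b bc(2) m]] S(3)[of b 0] S(3)[of c i]
      by (simp add: S(2) K.commutator_in)
  qed
qed

lemma tau_0_hom:
  assumes g: "g \<in> carrier G"
  shows "eg_lie_hom (gr K Ks) (gr K Ks) (T 0 (G.cls 0 g))"
proof (intro eg_lie_hom.intro eg_lie_hom_axioms.intro KL.eg_lie_algebra_axioms)
  note S = K.gr_carrier tau_0_cls[OF g] phi_mem[OF g] K.term_carrier K.commutator_in
  show "T 0 (G.cls 0 g) m \<in> hom (KL.P m) (KL.P m)" for m
    using g by (auto simp: hom_def S phi_mult)
  show "T 0 (G.cls 0 g) (m + n) (KL.br m n x y) = KL.br m n (T 0 (G.cls 0 g) m x) (T 0 (G.cls 0 g) n y)"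
    if "x \<in> KL.C m" "y \<in> KL.C n" for m n x y
    using that g by (auto simp: S phi_commutator)
  show "T 0 (G.cls 0 g) m (KL.act m h y) = KL.act m (T 0 (G.cls 0 g) 0 h) (T 0 (G.cls 0 g) m y)"
    if "h \<in> KL.C 0" "y \<in> KL.C m" for m h y
    using that g by (auto simp: S K.term_0 phi_mult phi_inv)
qed

lemma tau_0_closed:
  assumes g: "g \<in> carrier G"
  shows "T 0 (G.cls 0 g) \<in> eg_aut (gr K Ks)"
  by (rule KL.eg_autI[OF tau_ext tau_0_hom[OF g] tau_0_hom[of "inv\<^bsub>G\<^esub> g"]])
    (use g in \<open>auto simp: K.gr_carrier tau_0_cls phi_inverse K.term_carrier\<close>)

lemma tau_group_hom: "group_hom (egl_part (gr G Gs) m) (egl_part (Der (gr K Ks)) m) (T m)"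
proof (cases "m = 0")
  case True
  have "T 0 (U \<otimes>\<^bsub>egl_part (gr G Gs) 0\<^esub> V) = T 0 U \<otimes>\<^bsub>eg_aut_group (gr K Ks)\<^esub> T 0 V"
    if mem: "U \<in> carrier (egl_part (gr G Gs) 0)" "V \<in> carrier (egl_part (gr G Gs) 0)" for U V
  proof
    fix i
    obtain g h where gh: "g \<in> carrier G" "h \<in> carrier G" "U = G.cls 0 g" "V = G.cls 0 h"
      using mem by (auto simp: G.gr_carrier G.term_0)
    show "T 0 (U \<otimes>\<^bsub>egl_part (gr G Gs) 0\<^esub> V) i = (T 0 U \<otimes>\<^bsub>eg_aut_group (gr K Ks)\<^esub> T 0 V) i"
      by (rule extensionalityI[OF tau_ext])
        (use gh in \<open>auto simp: eg_aut_group_def K.gr_carrier compose_eq tau_0_cls phi_comp K.term_carrier G.term_0\<close>)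
  qed
  then have "T 0 \<in> hom (egl_part (gr G Gs) 0) (eg_aut_group (gr K Ks))"
    by (intro homI) (auto simp: G.gr_carrier G.term_0 tau_0_closed eg_aut_group_def)
  then show ?thesis
    using True KL.eg_aut_group_group by (simp add: group_hom_def group_hom_axioms_def Der_def)
next
  case False
  then have m: "0 < m" by simp
  have "T m (U \<otimes>\<^bsub>egl_part (gr G Gs) m\<^esub> V) = T m U \<otimes>\<^bsub>eg_der_group (gr K Ks) m\<^esub> T m V"
    if mem: "U \<in> carrier (egl_part (gr G Gs) m)" "V \<in> carrier (egl_part (gr G Gs) m)" for U V
  proof -
    obtain g h where gh: "g \<in> Gs m" "h \<in> Gs m" and UV: "U = G.cls m g" "V = G.cls m h"
      using mem by (auto simp: G.gr_carrier)
    have "T m (U \<otimes>\<^bsub>egl_part (gr G Gs) m\<^esub> V) i x = (T m U \<otimes>\<^bsub>eg_der_group (gr K Ks) m\<^esub> T m V) i x"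
      if x: "x \<in> KL.C i" for i x
    proof -
      obtain a where a: "a \<in> Ks i" "x = K.cls i a"
        using x by (auto simp: K.gr_carrier)
      have "K.cong (Suc (m + i)) (acomm (g \<otimes>\<^bsub>G\<^esub> h) a) (acomm h a \<otimes>\<^bsub>K\<^esub> acomm g a)"
        by (rule acomm_mult_left_cong[OF gh a(1)]) (use m in simp)
      also have "K.cong (Suc (m + i)) \<dots> (acomm g a \<otimes>\<^bsub>K\<^esub> acomm h a)"
        by (rule K.cong_commute[OF action_series[OF gh(2) a(1)] action_series[OF gh(1) a(1)]]) (use m in simp)
      finally show ?thesis
        using m gh a action_series by (simp add: UV KL.eg_der_group_apply tau_pos_cls K.cls_eqI)
    qed
    then show ?thesis
      by (intro KL.eg_der_eqI[of _ m] KL.eg_der_mult m) (use gh m in \<open>auto simp: UV tau_pos_closed\<close>)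
  qed
  then have "T m \<in> hom (egl_part (gr G Gs) m) (eg_der_group (gr K Ks) m)"
    by (intro homI) (auto simp: G.gr_carrier tau_pos_closed m)
  then show ?thesis
    using m KL.eg_der_group_comm[OF m]
    by (simp add: group_hom_def group_hom_axioms_def Der_def comm_group_def)
qed

text \<open>
  Both cases in the definition of the bracket of derivations come from the same congruence for $[[g,h],a]$. Its
  last factor $[[g,a],[h,a]]$ is kept for $i = 0$ and lies in $K_{m+n+i+1}$ for $i \ge 1$.
\<close>

lemma tau_bracket:
  assumes pos: "0 < m" "0 < n" and g: "g \<in> Gs m" and h: "h \<in> Gs n"
  shows "T (m + n) (G.cls (m + n) (commutator G g h)) =
    eg_der_bracket (gr K Ks) m n (T m (G.cls m g)) (T n (G.cls n h))"
proof -
  have k: "commutator G g h \<in> Gs (m + n)" using G.commutator_in g h by blast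
  have mem: "acomm g (acomm h a) \<in> Ks (m + n + i)" "acomm h (acomm g a) \<in> Ks (m + n + i)"
    "commutator K (acomm g a) (acomm h a) \<in> Ks (m + n + i)" "acomm g a \<in> Ks (m + i)" "acomm h a \<in> Ks (n + i)"
    if "a \<in> Ks i" for a i
    using that action_series[OF g] action_series[OF h] acomm_mem[OF g action_series[OF h that]]
      acomm_mem[OF h action_series[OF g that]] K.commutator_mem[of "acomm g a" "m + i" "acomm h a" "n + i"]
    by simp_all
  have main: "K.cls (m + n + i) (acomm (commutator G g h) a) = K.cls (m + n + i)
      (acomm g (acomm h a) \<otimes>\<^bsub>K\<^esub> inv\<^bsub>K\<^esub> (acomm h (acomm g a)) \<otimes>\<^bsub>K\<^esub> inv\<^bsub>K\<^esub> (commutator K (acomm g a) (acomm h a)))"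
    if "a \<in> Ks i" for a i
    by (rule K.cls_eqI[OF acomm_commutator_left[OF g h that pos]])
  show ?thesis
  proof (rule KL.eg_der_eqI[of _ "m + n"])
    fix x assume "x \<in> KL.C 0"
    then obtain a where a: "a \<in> Ks 0" "x = K.cls 0 a" by (auto simp: K.gr_carrier)
    show "T (m + n) (G.cls (m + n) (commutator G g h)) 0 x =
        eg_der_bracket (gr K Ks) m n (T m (G.cls m g)) (T n (G.cls n h)) 0 x"
      using a main[OF a(1)] mem[OF a(1)] pos g h k
      by (simp add: KL.eg_der_bracket_0 tau_pos_cls add.commute[of n m])
  next
    fix i x assume i: "0 < i" and "x \<in> KL.C i"
    then obtain a where a: "a \<in> Ks i" "x = K.cls i a" by (auto simp: K.gr_carrier)
    have c: "acomm g (acomm h a) \<in> carrier K" "acomm h (acomm g a) \<in> carrier K"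
      using mem[OF a(1)] K.term_carrier by blast+
    have "commutator K (acomm g a) (acomm h a) \<in> Ks (Suc (m + n + i))"
      by (rule K.commutator_mem[OF mem(4,5)[OF a(1)]]) (use i in simp)
    then have "K.cls (m + n + i)
      (acomm g (acomm h a) \<otimes>\<^bsub>K\<^esub> inv\<^bsub>K\<^esub> (acomm h (acomm g a)) \<otimes>\<^bsub>K\<^esub> inv\<^bsub>K\<^esub> (commutator K (acomm g a) (acomm h a)))
      = K.cls (m + n + i) (acomm g (acomm h a) \<otimes>\<^bsub>K\<^esub> inv\<^bsub>K\<^esub> (acomm h (acomm g a)))"
      using K.cls_eqI[OF K.cong_mult[OF K.cong_refl K.cong_one]] c
      by (metis K.inv_closed K.m_closed K.r_one K.term_inv le_refl)
    then show "T (m + n) (G.cls (m + n) (commutator G g h)) i x =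
        eg_der_bracket (gr K Ks) m n (T m (G.cls m g)) (T n (G.cls n h)) i x"
      using a main[OF a(1)] mem[OF a(1)] pos g h k i
      by (simp add: KL.eg_der_bracket_pos tau_pos_cls add_ac)
  qed (use tau_pos_closed pos g h k KL.eg_der_bracket_closed in simp_all)
qed

text \<open>
  This is the exact identity $[ghg^{-1}, g(b)] = g([h, b])$ with $b = g^{-1}(a)$.
\<close>

lemma tau_act:
  assumes m: "0 < m" and g: "g \<in> carrier G" and h: "h \<in> Gs m"
  shows "T m (G.cls m (g \<otimes>\<^bsub>G\<^esub> h \<otimes>\<^bsub>G\<^esub> inv\<^bsub>G\<^esub> g)) =
    eg_der_act (gr K Ks) m (T 0 (G.cls 0 g)) (T m (G.cls m h))"
proof -
  have "T m (G.cls m (g \<otimes>\<^bsub>G\<^esub> h \<otimes>\<^bsub>G\<^esub> inv\<^bsub>G\<^esub> g)) i x =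
      eg_der_act (gr K Ks) m (T 0 (G.cls 0 g)) (T m (G.cls m h)) i x" if x: "x \<in> KL.C i" for i x
  proof -
    obtain a where a: "a \<in> Ks i" "x = K.cls i a" using x by (auto simp: K.gr_carrier)
    define b where "b = \<phi> (inv\<^bsub>G\<^esub> g) a"
    have b: "b \<in> Ks i" "\<phi> g b = a"
      using a g K.term_carrier by (auto simp: b_def phi_inverse)
    have c: "h \<in> carrier G" "b \<in> carrier K" using h b G.term_carrier K.term_carrier by auto
    have "T 0 (G.cls 0 g) i (K.cls i b) = x"
      using a b g by (simp add: tau_0_cls)
    then have "inv_into (KL.C i) (T 0 (G.cls 0 g) i) x = K.cls i b"
      using KL.eg_aut_inv_left[OF tau_0_closed[OF g], of "K.cls i b" i] b by simp
    then show ?thesis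
      using m g h a b c x acomm_conj[of g h b] action_series[OF h b(1)]
      by (simp add: KL.eg_der_act_apply tau_pos_closed tau_pos_cls tau_0_cls)
  qed
  then show ?thesis
    by (intro KL.eg_der_eqI[of _ m] KL.eg_der_act_closed tau_pos_closed tau_0_closed m) (use g h in auto)
qed

theorem tau_morphism: "eg_lie_hom (gr G Gs) (Der (gr K Ks)) T"
proof (intro eg_lie_hom.intro eg_lie_hom_axioms.intro G.eg_lie_algebra_gr KL.eg_lie_algebra_Der)
  show "T m \<in> hom (egl_part (gr G Gs) m) (egl_part (Der (gr K Ks)) m)" for m
    using tau_group_hom by (simp add: group_hom_def group_hom_axioms_def)
  show "T (m + n) (egl_bracket (gr G Gs) m n x y) = egl_bracket (Der (gr K Ks)) m n (T m x) (T n y)"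
    if "1 \<le> m" "1 \<le> n" "x \<in> carrier (egl_part (gr G Gs) m)" "y \<in> carrier (egl_part (gr G Gs) n)" for m n x y
    using that by (auto simp: G.gr_carrier tau_bracket Der_def)
  show "T m (egl_act (gr G Gs) m g y) = egl_act (Der (gr K Ks)) m (T 0 g) (T m y)"
    if "1 \<le> m" "g \<in> carrier (egl_part (gr G Gs) 0)" "y \<in> carrier (egl_part (gr G Gs) m)" for m g y
    using that by (auto simp: G.gr_carrier G.term_0 tau_act Der_def)
qed

section \<open>Injectivity and the Johnson filtration\<close>

abbreviation "F \<equiv> johnson_filtration G K Ks \<phi>"

lemma tau_eq_one_iff:
  assumes g: "g \<in> Gs m"
  shows "T m (G.cls m g) = \<one>\<^bsub>egl_part (Der (gr K Ks)) m\<^esub> \<longleftrightarrow> g \<in> F (Suc m)"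
proof -
  have gc: "g \<in> carrier G" using g G.term_carrier by blast
  have pointwise: "T m (G.cls m g) i (K.cls i a) = \<one>\<^bsub>egl_part (Der (gr K Ks)) m\<^esub> i (K.cls i a) \<longleftrightarrow>
      acomm g a \<in> Ks (Suc m + i)" if a: "a \<in> Ks i" for i a
  proof (cases "m = 0")
    case True
    then show ?thesis
      using a gc K.term_carrier[OF a] K.cong_iff_diff[of "\<phi> g a" a "Suc i"]
      by (simp add: tau_0_cls Der_def eg_aut_group_def K.cls_eq_iff act_commutator_def)
  next
    case False
    then show ?thesis
      using a g action_series[OF g a]
      by (simp add: tau_pos_cls Der_def eg_der_group_def K.cls_eq_one_iff)
  qed
  have "T m (G.cls m g) = \<one>\<^bsub>egl_part (Der (gr K Ks)) m\<^esub> \<longleftrightarrow>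
      (\<forall>i. T m (G.cls m g) i = \<one>\<^bsub>egl_part (Der (gr K Ks)) m\<^esub> i)"
    by auto
  also have "\<dots> \<longleftrightarrow> (\<forall>i. \<forall>a\<in>Ks i. T m (G.cls m g) i (K.cls i a) = \<one>\<^bsub>egl_part (Der (gr K Ks)) m\<^esub> i (K.cls i a))"
  proof (intro iffI allI)
    fix i assume *: "\<forall>i. \<forall>a\<in>Ks i. T m (G.cls m g) i (K.cls i a) = \<one>\<^bsub>egl_part (Der (gr K Ks)) m\<^esub> i (K.cls i a)"
    have "\<one>\<^bsub>egl_part (Der (gr K Ks)) m\<^esub> i \<in> extensional (KL.C i)"
      by (simp add: Der_def eg_aut_group_def eg_der_group_def)
    then show "T m (G.cls m g) i = \<one>\<^bsub>egl_part (Der (gr K Ks)) m\<^esub> i"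
      by (rule extensionalityI[OF tau_ext]) (use * in \<open>auto simp: K.gr_carrier\<close>)
  qed simp
  finally show ?thesis
    using gc by (simp add: pointwise johnson_filtration_def)
qed

text \<open>
  The kernel of $\bar\tau_m$ consists of the classes of $G_m \cap F_{m+1}$, and such a class is
  trivial when its representative lies in $G_{m+1}$.
\<close>

lemma tau_inj_iff:
  "inj_on (T m) (carrier (egl_part (gr G Gs) m)) \<longleftrightarrow> Gs m \<inter> F (Suc m) \<subseteq> Gs (Suc m)"
  unfolding group_hom.inj_on_one_iff[OF tau_group_hom]
  by (auto simp: G.gr_carrier tau_eq_one_iff G.cls_eq_one_iff del: equalityI)

text \<open>
  If all $\bar\tau_m$ are injective and $F_m \subseteq G_m$, then
  $F_{m+1} \subseteq F_m \cap F_{m+1} \subseteq G_m \cap F_{m+1} \subseteq G_{m+1}$; the induction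
  starts at $F_0 \subseteq G_0$, the whole group.
\<close>

lemma tau_inj_iff_johnson:
  "(\<forall>m. inj_on (T m) (carrier (egl_part (gr G Gs) m))) \<longleftrightarrow> (\<forall>m. Gs m = F m)"
proof
  assume "\<forall>m. Gs m = F m"
  then show "\<forall>m. inj_on (T m) (carrier (egl_part (gr G Gs) m))"
    by (simp add: tau_inj_iff)
next
  assume inj: "\<forall>m. inj_on (T m) (carrier (egl_part (gr G Gs) m))"
  have le: "Gs m \<subseteq> F m" for m
    using action_series G.term_carrier by (auto simp: johnson_filtration_def)
  have "F m \<subseteq> Gs m" for m
  proof (induction m)
    case 0
    then show ?case by (auto simp: johnson_filtration_def G.term_0)
  next
    case (Suc m)
    have "F (Suc m) \<subseteq> F m"
      by (auto simp: johnson_filtration_def intro: subsetD[OF K.term_decreasing])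
    then show ?case using Suc inj by (auto simp: tau_inj_iff)
  qed
  then show "\<forall>m. Gs m = F m" using le by blast
qed

end

theorem theorem6p4:
  fixes G :: "('g, 'c) monoid_scheme" and Gs :: "nat \<Rightarrow> 'g set"
    and K :: "('k, 'd) monoid_scheme" and Ks :: "nat \<Rightarrow> 'k set"
    and \<phi> :: "'g \<Rightarrow> 'k \<Rightarrow> 'k"
  assumes "ext_N_series_action G Gs K Ks \<phi>"
  shows "(\<forall>m. \<forall>g\<in>Gs m. \<forall>i. \<forall>a\<in>Ks i.
            tau K Ks \<phi> m (Gs (Suc m) #>\<^bsub>G\<^esub> g) i (Ks (Suc i) #>\<^bsub>K\<^esub> a) =
              (if m = 0 then Ks (Suc i) #>\<^bsub>K\<^esub> \<phi> g a
               else Ks (Suc (m + i)) #>\<^bsub>K\<^esub> act_commutator K \<phi> g a))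
       \<and> eg_lie_hom (gr G Gs) (Der (gr K Ks)) (tau K Ks \<phi>)
       \<and> ((\<forall>m. inj_on (tau K Ks \<phi> m) (carrier (egl_part (gr G Gs) m)))
            \<longleftrightarrow> (\<forall>m. Gs m = johnson_filtration G K Ks \<phi> m))"
proof -
  interpret ext_N_series_action G Gs K Ks \<phi> by (rule assms)
  show ?thesis
    using tau_cls tau_morphism tau_inj_iff_johnson by (simp add: tau_rep_def)
qed

end
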